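(* Let $T:V\to\mathfrak g$ be a relative Rota-Baxter operator on a Lie-Yamaguti algebra $(\mathfrak g,[\cdot,\cdot],[\![\cdot,\cdot,\cdot]\!])$ (over a field $\mathbb K$ of characteristic $0$) with respect to a representation $(V;\rho,\mu)$, and let $T_t=\sum_{i=0}^n\mathfrak T_it^i$ be an order $n$ deformation of $T$. Then $T_t$ is extensible if and only if the cohomology class $[\mathsf{Ob}^T]\in\mathcal H^2_T(V,\mathfrak g)$ is trivial, where $\mathsf{Ob}^T=(\mathsf{Ob}^T_{\rm I},\mathsf{Ob}^T_{\rm II})\in\mathcal C^2_T(V,\mathfrak g)$ is defined by, for all $v_1,v_2,v_3\in V$, $$\mathsf{Ob}^T_{\rm I}(v_1,v_2)=\sum_{\substack{i+j=n+1\\ i,j\ge1}}\Big([\mathfrak T_iv_1,\mathfrak T_jv_2]-\mathfrak T_i\big(\rho(\mathfrak T_jv_1)v_2-\rho(\mathfrak T_jv_2)v_1\big)\Big),$$ $$\mathsf{Ob}^T_{\rm II}(v_1,v_2,v_3)=\sum_{\substack{i+j+k=n+1\\ i,j,k\ge1}}\Big([\![\mathfrak T_iv_1,\mathfrak T_jv_2,\mathfrak T_kv_3]\!]-\mathfrak T_i\big(D(\mathfrak T_jv_1,\mathfrak T_kv_2)v_3+\mu(\mathfrak T_jv_2,\mathfrak T_kv_3)v_1-\mu(\mathfrak T_jv_1,\mathfrak T_kv_3)v_2\big)\Big).$$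
   Context: Lie-Yamaguti algebra: a vector space $\mathfrak g$ with a bilinear bracket $[\cdot,\cdot]:\wedge^2\mathfrak g\to\mathfrak g$ and a trilinear bracket $[\![\cdot,\cdot,\cdot]\!]:\wedge^2\mathfrak g\otimes\mathfrak g\to\mathfrak g$ such that for all $x,y,z,w,t\in\mathfrak g$: (1) $[[x,y],z]+[[y,z],x]+[[z,x],y]+[\![x,y,z]\!]+[\![y,z,x]\!]+[\![z,x,y]\!]=0$; (2) $[\![[x,y],z,w]\!]+[\![[y,z],x,w]\!]+[\![[z,x],y,w]\!]=0$; (3) $[\![x,y,[z,w]]\!]=[[\![x,y,z]\!],w]+[z,[\![x,y,w]\!]]$; (4) $[\![x,y,[\![z,w,t]\!]]\!]=[\![[\![x,y,z]\!],w,t]\!]+[\![z,[\![x,y,w]\!],t]\!]+[\![z,w,[\![x,y,t]\!]]\!]$. Representation $(V;\rho,\mu)$: a vector space $V$ with linear maps $\rho:\mathfrak g\to\mathfrak{gl}(V)$, $\mu:\otimes^2\mathfrak g\to\mathfrak{gl}(V)$ such that, with $D(x,y)=D_{\rho,\mu}(x,y):=\mu(y,x)-\mu(x,y)+[\rho(x),\rho(y)]-\rho([x,y])$, for all $x,y,z,w\in\mathfrak g$: $\mu([x,y],z)-\mu(x,z)\rho(y)+\mu(y,z)\rho(x)=0$; $\mu(x,[y,z])-\rho(y)\mu(x,z)+\rho(z)\mu(x,y)=0$; $\rho([\![x,y,z]\!])=[D(x,y),\rho(z)]$; $\mu(z,w)\mu(x,y)-\mu(y,w)\mu(x,z)-\mu(x,[\![y,z,w]\!])+D(y,z)\mu(x,w)=0$;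 $\mu([\![x,y,z]\!],w)+\mu(z,[\![x,y,w]\!])=[D(x,y),\mu(z,w)]$. Relative Rota-Baxter operator on $\mathfrak g$ with respect to $(V;\rho,\mu)$: a linear map $T:V\to\mathfrak g$ with, for all $u,v,w\in V$, $[Tu,Tv]=T(\rho(Tu)v-\rho(Tv)u)$ and $[\![Tu,Tv,Tw]\!]=T(D(Tu,Tv)w+\mu(Tv,Tw)u-\mu(Tu,Tw)v)$. Order $n$ deformation of $T$: $T_t=\sum_{i=0}^n\mathfrak T_it^i$ with $\mathfrak T_0=T$, $\mathfrak T_i\in\mathrm{Hom}_{\mathbb K}(V,\mathfrak g)$, regarded as a $\mathbb K[t]/(t^{n+1})$-module map $V[t]/(t^{n+1})\to\mathfrak g[t]/(t^{n+1})$ (all structure maps extended $\mathbb K[t]/(t^{n+1})$-multilinearly), such that modulo $t^{n+1}$, for all $u,v,w\in V$, $[T_tu,T_tv]=T_t(\rho(T_tu)v-\rho(T_tv)u)$ and $[\![T_tu,T_tv,T_tw]\!]=T_t(D(T_tu,T_tv)w+\mu(T_tv,T_tw)u-\mu(T_tu,T_tw)v)$. It is extensible if there is $\mathfrak T_{n+1}\in\mathrm{Hom}_{\mathbb K}(V,\mathfrak g)$ such that $T_t+\mathfrak T_{n+1}t^{n+1}$ is an order $n+1$ deformation of $T$. Cohomology: put $[u,v]_T=\rho(Tu)v-\rho(Tv)u$, $[\![u,v,w]\!]_T=D(Tu,Tv)w+\mu(Tv,Tw)u-\mu(Tu,Tw)v$ (a Lie-Yamaguti algebra structure on $V$), with representation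 $(\mathfrak g;\varrho,\varpi)$: $\varrho(u)x=[Tu,x]+T(\rho(x)u)$, $\varpi(u,v)x=[\![x,Tu,Tv]\!]-T(D(x,Tu)v-\mu(x,Tv)u)$, $D_{\varrho,\varpi}(u,v)x=[\![Tu,Tv,x]\!]-T(\mu(Tv,x)u-\mu(Tu,x)v)$. Let $\mathcal C^1_T(V,\mathfrak g)=\mathrm{Hom}(V,\mathfrak g)$, $\mathcal C^2_T(V,\mathfrak g)=\mathrm{Hom}(\wedge^2V,\mathfrak g)\times\mathrm{Hom}(\wedge^2V\otimes V,\mathfrak g)$. The Yamaguti coboundary $\delta^T=(\delta^T_{\rm I},\delta^T_{\rm II})$ is, for $f\in\mathcal C^1_T$, $\delta^T_{\rm I}f(u,v)=\varrho(u)f(v)-\varrho(v)f(u)-f([u,v]_T)$, $\delta^T_{\rm II}f(u,v,w)=D_{\varrho,\varpi}(u,v)f(w)+\varpi(v,w)f(u)-\varpi(u,w)f(v)-f([\![u,v,w]\!]_T)$; and for $F=(f,g)\in\mathcal C^2_T$, with $\mathcal V_i=u_i\wedge v_i\in\wedge^2V$, $\mathcal V_1\circ\mathcal V_2=[\![u_1,v_1,u_2]\!]_T\wedge v_2+u_2\wedge[\![u_1,v_1,v_2]\!]_T$, $$\delta^T_{\rm I}F(\mathcal V_1,\mathcal V_2)=-\varrho(u_2)g(\mathcal V_1,v_2)+\varrho(v_2)g(\mathcal V_1,u_2)+g(\mathcal V_1,[u_2,v_2]_T)+D_{\varrho,\varpi}(\mathcal V_1)f(\mathcal V_2)-f(\mathcal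 V_1\circ\mathcal V_2),$$ $$\delta^T_{\rm II}F(\mathcal V_1,\mathcal V_2,w)=-\varpi(v_2,w)g(\mathcal V_1,u_2)+\varpi(u_2,w)g(\mathcal V_1,v_2)+D_{\varrho,\varpi}(\mathcal V_1)g(\mathcal V_2,w)-D_{\varrho,\varpi}(\mathcal V_2)g(\mathcal V_1,w)$$ $$-g(\mathcal V_1\circ\mathcal V_2,w)-g(\mathcal V_2,[\![u_1,v_1,w]\!]_T)+g(\mathcal V_1,[\![u_2,v_2,w]\!]_T).$$ $\mathcal H^2_T(V,\mathfrak g)=\mathcal Z^2_T/\mathcal B^2_T$ with $\mathcal Z^2_T=\{F\in\mathcal C^2_T:\delta^T_{\rm I}F=0,\ \delta^T_{\rm II}F=0\}$ and $\mathcal B^2_T=\{\delta^Tf:f\in\mathcal C^1_T\}$; a class is trivial if its representative lies in $\mathcal B^2_T$.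
   Formalization: In Ob_II the sum runs over i+j+k=n+1 with 0≤i,j,k≤n instead of i,j,k≥1; the printed range omits terms with exactly one index 0, and the claim is then false (e.g. n=1, ρ=μ=0, [[a,b,b]]=c=-[[b,a,b]], Te=a, Te'=0, T_1e=0, T_1e'=b). *)

theory Defs
  imports "HOL-Computational_Algebra.Polynomial"
begin

section \<open>Multilinear maps\<close>

text \<open>
  Vector spaces over \<^typ>\<open>'k\<close> are types \<^typ>\<open>'a::ab_group_add\<close> with an explicit scalar
  multiplication \<open>s\<close> such that \<open>vector_space s\<close>. Maps on \<open>\<and>\<^sup>2\<close> are alternating bilinear maps,
  and maps into \<open>\<gg>\<ll>(V)\<close> are curried.
\<close>

definition bilinear_map ::
  "('k::field \<Rightarrow> 'a::ab_group_add \<Rightarrow> 'a) \<Rightarrow> ('k \<Rightarrow> 'b::ab_group_add \<Rightarrow> 'b) \<Rightarrow>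
   ('k \<Rightarrow> 'c::ab_group_add \<Rightarrow> 'c) \<Rightarrow> ('a \<Rightarrow> 'b \<Rightarrow> 'c) \<Rightarrow> bool" where
  "bilinear_map s1 s2 s3 f \<longleftrightarrow>
     (\<forall>y. Vector_Spaces.linear s1 s3 (\<lambda>x. f x y)) \<and>
     (\<forall>x. Vector_Spaces.linear s2 s3 (\<lambda>y. f x y))"

definition trilinear_map ::
  "('k::field \<Rightarrow> 'a::ab_group_add \<Rightarrow> 'a) \<Rightarrow> ('k \<Rightarrow> 'b::ab_group_add \<Rightarrow> 'b) \<Rightarrow>
   ('k \<Rightarrow> 'c::ab_group_add \<Rightarrow> 'c) \<Rightarrow> ('k \<Rightarrow> 'd::ab_group_add \<Rightarrow> 'd) \<Rightarrow>
   ('a \<Rightarrow> 'b \<Rightarrow> 'c \<Rightarrow> 'd) \<Rightarrow> bool" where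
  "trilinear_map s1 s2 s3 s4 f \<longleftrightarrow>
     (\<forall>y z. Vector_Spaces.linear s1 s4 (\<lambda>x. f x y z)) \<and>
     (\<forall>x z. Vector_Spaces.linear s2 s4 (\<lambda>y. f x y z)) \<and>
     (\<forall>x y. Vector_Spaces.linear s3 s4 (\<lambda>z. f x y z))"


section \<open>Lie-Yamaguti algebras, representations, relative Rota-Baxter operators\<close>

locale lie_yamaguti_algebra = vector_space sg
  for sg :: "'k::field_char_0 \<Rightarrow> 'g::ab_group_add \<Rightarrow> 'g" +
  fixes br :: "'g \<Rightarrow> 'g \<Rightarrow> 'g"
    and tr :: "'g \<Rightarrow> 'g \<Rightarrow> 'g \<Rightarrow> 'g"
  assumes br_bilinear: "bilinear_map sg sg sg br"
    and br_alternating: "br x x = 0"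
    and tr_trilinear: "trilinear_map sg sg sg sg tr"
    and tr_alternating: "tr x x z = 0"
    and LY1: "br (br x y) z + br (br y z) x + br (br z x) y + tr x y z + tr y z x + tr z x y = 0"
    and LY2: "tr (br x y) z w + tr (br y z) x w + tr (br z x) y w = 0"
    and LY3: "tr x y (br z w) = br (tr x y z) w + br z (tr x y w)"
    and LY4: "tr x y (tr z w t) = tr (tr x y z) w t + tr z (tr x y w) t + tr z w (tr x y t)"

definition rep_D ::
  "('g \<Rightarrow> 'g \<Rightarrow> 'g) \<Rightarrow> ('g \<Rightarrow> 'v \<Rightarrow> 'v) \<Rightarrow> ('g \<Rightarrow> 'g \<Rightarrow> 'v \<Rightarrow> 'v) \<Rightarrow>
   'g \<Rightarrow> 'g \<Rightarrow> 'v \<Rightarrow> 'v::ab_group_add" where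
  "rep_D br \<rho> \<mu> x y v =
     \<mu> y x v - \<mu> x y v + (\<rho> x (\<rho> y v) - \<rho> y (\<rho> x v)) - \<rho> (br x y) v"

locale lie_yamaguti_representation =
  lie_yamaguti_algebra sg br tr + V: vector_space sv
  for sg :: "'k::field_char_0 \<Rightarrow> 'g::ab_group_add \<Rightarrow> 'g"
    and br :: "'g \<Rightarrow> 'g \<Rightarrow> 'g"
    and tr :: "'g \<Rightarrow> 'g \<Rightarrow> 'g \<Rightarrow> 'g"
    and sv :: "'k \<Rightarrow> 'v::ab_group_add \<Rightarrow> 'v" +
  fixes \<rho> :: "'g \<Rightarrow> 'v \<Rightarrow> 'v"
    and \<mu> :: "'g \<Rightarrow> 'g \<Rightarrow> 'v \<Rightarrow> 'v"
  assumes rho_linear: "bilinear_map sg sv sv \<rho>"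
    and mu_linear: "trilinear_map sg sg sv sv \<mu>"
    and rep1: "\<mu> (br x y) z v - \<mu> x z (\<rho> y v) + \<mu> y z (\<rho> x v) = 0"
    and rep2: "\<mu> x (br y z) v - \<rho> y (\<mu> x z v) + \<rho> z (\<mu> x y v) = 0"
    and rep3: "\<rho> (tr x y z) v = rep_D br \<rho> \<mu> x y (\<rho> z v) - \<rho> z (rep_D br \<rho> \<mu> x y v)"
    and rep4: "\<mu> z w (\<mu> x y v) - \<mu> y w (\<mu> x z v) - \<mu> x (tr y z w) v
                 + rep_D br \<rho> \<mu> y z (\<mu> x w v) = 0"
    and rep5: "\<mu> (tr x y z) w v + \<mu> z (tr x y w) v
                 = rep_D br \<rho> \<mu> x y (\<mu> z w v) - \<mu> z w (rep_D br \<rho> \<mu> x y v)"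

definition relative_rota_baxter where
  "relative_rota_baxter sg br tr sv \<rho> \<mu> T \<longleftrightarrow>
     Vector_Spaces.linear sv sg T \<and>
     (\<forall>u v. br (T u) (T v) = T (\<rho> (T u) v - \<rho> (T v) u)) \<and>
     (\<forall>u v w. tr (T u) (T v) (T w) =
        T (rep_D br \<rho> \<mu> (T u) (T v) w + \<mu> (T v) (T w) u - \<mu> (T u) (T w) v))"


section \<open>Deformations of finite order\<close>

text \<open>
  \<open>V[t]\<close> is the type \<^typ>\<open>'v poly\<close>, for which the library only needs \<^typ>\<open>'v\<close> to be an additive
  group; the constant \<open>v\<close> is \<open>[:v:]\<close>. Equality in \<open>V[t]/(t\<^sup>m)\<close> is congruence of
  representatives. The maps \<open>ext2\<close> and \<open>ext3\<close> are the \<open>\<bbbK>[t]\<close>-multilinear extensions of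
  multilinear maps (with \<open>\<mu>\<close> and \<open>D\<close> viewed as trilinear maps), and \<open>deformation_map \<TT> n\<close>
  is the \<open>\<bbbK>[t]\<close>-linear extension of \<open>v \<mapsto> \<Sum>i\<le>n. (\<TT> i v) t\<^sup>i\<close>. All of them are compatible with
  the congruence.
\<close>

definition cong_mod_t :: "nat \<Rightarrow> 'a::zero poly \<Rightarrow> 'a poly \<Rightarrow> bool" where
  "cong_mod_t m p q \<longleftrightarrow> (\<forall>k<m. coeff p k = coeff q k)"

definition ext2 ::
  "('a::zero \<Rightarrow> 'b::zero \<Rightarrow> 'c::ab_group_add) \<Rightarrow> 'a poly \<Rightarrow> 'b poly \<Rightarrow> 'c poly" where
  "ext2 f p q = (\<Sum>i\<le>degree p. \<Sum>j\<le>degree q. monom (f (coeff p i) (coeff q j)) (i + j))"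

definition ext3 ::
  "('a::zero \<Rightarrow> 'b::zero \<Rightarrow> 'c::zero \<Rightarrow> 'd::ab_group_add) \<Rightarrow>
   'a poly \<Rightarrow> 'b poly \<Rightarrow> 'c poly \<Rightarrow> 'd poly" where
  "ext3 f p q r =
     (\<Sum>i\<le>degree p. \<Sum>j\<le>degree q. \<Sum>k\<le>degree r.
        monom (f (coeff p i) (coeff q j) (coeff r k)) (i + j + k))"

definition deformation_map ::
  "(nat \<Rightarrow> 'v::zero \<Rightarrow> 'g::ab_group_add) \<Rightarrow> nat \<Rightarrow> 'v poly \<Rightarrow> 'g poly" where
  "deformation_map \<TT> n p = (\<Sum>i\<le>n. \<Sum>j\<le>degree p. monom (\<TT> i (coeff p j)) (i + j))"

text \<open>Only \<open>\<TT> 0, \<dots>, \<TT> n\<close> matter below; the remaining values of \<open>\<TT>\<close> are ignored.\<close>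

definition is_deformation where
  "is_deformation sg br tr sv \<rho> \<mu> T n \<TT> \<longleftrightarrow>
     \<TT> 0 = T \<and>
     (\<forall>i\<le>n. Vector_Spaces.linear sv sg (\<TT> i)) \<and>
     (let T\<^sub>t = deformation_map \<TT> n; D = rep_D br \<rho> \<mu> in
       (\<forall>u v. cong_mod_t (n + 1)
          (ext2 br (T\<^sub>t [:u:]) (T\<^sub>t [:v:]))
          (T\<^sub>t (ext2 \<rho> (T\<^sub>t [:u:]) [:v:] - ext2 \<rho> (T\<^sub>t [:v:]) [:u:]))) \<and>
       (\<forall>u v w. cong_mod_t (n + 1)
          (ext3 tr (T\<^sub>t [:u:]) (T\<^sub>t [:v:]) (T\<^sub>t [:w:]))
          (T\<^sub>t (ext3 D (T\<^sub>t [:u:]) (T\<^sub>t [:v:]) [:w:]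
               + ext3 \<mu> (T\<^sub>t [:v:]) (T\<^sub>t [:w:]) [:u:]
               - ext3 \<mu> (T\<^sub>t [:u:]) (T\<^sub>t [:w:]) [:v:]))))"

definition is_extensible where
  "is_extensible sg br tr sv \<rho> \<mu> T n \<TT> \<longleftrightarrow>
     (\<exists>f. Vector_Spaces.linear sv sg f \<and>
          is_deformation sg br tr sv \<rho> \<mu> T (n + 1) (\<TT>(n + 1 := f)))"


section \<open>Cohomology of a relative Rota-Baxter operator\<close>

definition bracket_T where
  "bracket_T \<rho> T u v = \<rho> (T u) v - \<rho> (T v) u"

definition triple_T where
  "triple_T br \<rho> \<mu> T u v w =
     rep_D br \<rho> \<mu> (T u) (T v) w + \<mu> (T v) (T w) u - \<mu> (T u) (T w) v"

definition rho_T where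
  "rho_T br \<rho> T u x = br (T u) x + T (\<rho> x u)"

definition mu_T where
  "mu_T br tr \<rho> \<mu> T u v x = tr x (T u) (T v) - T (rep_D br \<rho> \<mu> x (T u) v - \<mu> x (T v) u)"

definition D_T where
  "D_T tr \<mu> T u v x = tr (T u) (T v) x - T (\<mu> (T v) x u - \<mu> (T u) x v)"

text \<open>\<^const>\<open>D_T\<close> is the map \<^const>\<open>rep_D\<close> associated with the representation on \<open>\<gg>\<close> of the induced algebra.\<close>

lemma D_T_eq:
  fixes sg :: "'k::field_char_0 \<Rightarrow> 'g::ab_group_add \<Rightarrow> 'g"
    and sv :: "'k \<Rightarrow> 'v::ab_group_add \<Rightarrow> 'v"
    and u v :: 'v and x :: 'g
  assumes "lie_yamaguti_representation sg br tr sv \<rho> \<mu>" "relative_rota_baxter sg br tr sv \<rho> \<mu> T"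
  shows "rep_D (bracket_T \<rho> T) (rho_T br \<rho> T) (mu_T br tr \<rho> \<mu> T) u v x = D_T tr \<mu> T u v x"
proof -
  interpret lie_yamaguti_representation sg br tr sv \<rho> \<mu> by fact
  interpret T: Vector_Spaces.linear sv sg T using assms(2) by (simp add: relative_rota_baxter_def)
  interpret b1: Vector_Spaces.linear sg sg "\<lambda>x. br x y" for y using br_bilinear by (simp add: bilinear_map_def)
  interpret b2: Vector_Spaces.linear sg sg "\<lambda>y. br x y" for x using br_bilinear by (simp add: bilinear_map_def)
  interpret r1: Vector_Spaces.linear sg sv "\<lambda>x. \<rho> x y" for y using rho_linear by (simp add: bilinear_map_def)
  interpret r2: Vector_Spaces.linear sv sv "\<lambda>y. \<rho> x y" for x using rho_linear by (simp add: bilinear_map_def)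
  interpret t1: Vector_Spaces.linear sg sg "\<lambda>x. tr x y z" for y z using tr_trilinear by (simp add: trilinear_map_def)
  interpret t2: Vector_Spaces.linear sg sg "\<lambda>y. tr x y z" for x z using tr_trilinear by (simp add: trilinear_map_def)
  have anti: "br y x = - br x y" for x y
  proof -
    have "br x y + br y x = 0"
      using br_alternating[of "x + y"] unfolding b1.add b2.add by (simp add: br_alternating add.commute)
    then show ?thesis by (rule minus_unique[symmetric])
  qed
  have antit: "tr y x z = - tr x y z" for x y z
  proof -
    have "tr x y z + tr y x z = 0"
      using tr_alternating[of "x + y" z] unfolding t1.add t2.add by (simp add: tr_alternating add.commute)
    then show ?thesis by (rule minus_unique[symmetric])
  qed
  have RB: "br (T u) (T v) = T (\<rho> (T u) v) - T (\<rho> (T v) u)" for u v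
    using assms(2) by (simp add: relative_rota_baxter_def T.diff)
  have J: "br (br (T u) (T v)) x = br (T u) (br (T v) x) - br (T v) (br (T u) x)
      - tr (T u) (T v) x - tr (T v) x (T u) + tr (T u) x (T v)" for x
  proof -
    have "br (br (T v) x) (T u) = - br (T u) (br (T v) x)" by (rule anti)
    moreover have "br (br x (T u)) (T v) = br (T v) (br (T u) x)"
      by (metis anti b2.neg minus_minus)
    moreover have "tr x (T u) (T v) = - tr (T u) x (T v)" by (rule antit)
    moreover have "a = - (b + c + d + e + f)" if "a + b + c + d + e + f = 0" for a b c d e f :: 'g
      using that by (simp only: eq_neg_iff_add_eq_0 add.assoc)
    ultimately show ?thesis
      using LY1[of "T u" "T v" x] by fastforce
  qed
  have TB: "T (bracket_T \<rho> T u v) = br (T u) (T v)"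
    by (simp add: bracket_T_def RB T.diff)
  have E: "rho_T br \<rho> T u (rho_T br \<rho> T v x) =
      br (T u) (br (T v) x) + T (\<rho> (T u) (\<rho> x v)) + T (\<rho> (br (T v) x) u)" for u v x
    by (simp add: rho_T_def b2.add r1.add T.add RB)
  have A: "br x (T u) = - br (T u) x" "tr x (T u) y = - tr (T u) x y" for u y x
    by (rule anti, rule antit)
  have R: "rho_T br \<rho> T (bracket_T \<rho> T u v) x =
      br (br (T u) (T v)) x + T (\<rho> x (\<rho> (T u) v)) - T (\<rho> x (\<rho> (T v) u))" for x
    by (simp add: rho_T_def TB) (simp add: bracket_T_def r2.diff T.diff)
  have M: "mu_T br tr \<rho> \<mu> T u v x = - tr (T u) x (T v)
      - T (\<mu> (T u) x v) + T (\<mu> x (T u) v) - T (\<rho> x (\<rho> (T u) v)) + T (\<rho> (T u) (\<rho> x v))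
      - T (\<rho> (br (T u) x) v) + T (\<mu> x (T v) u)" for u v x
    by (simp add: mu_T_def rep_D_def A r1.neg T.add T.diff T.neg)
  show ?thesis
    by (simp only: rep_D_def[of "bracket_T \<rho> T"], simp only: E R M, simp only: J D_T_def T.diff) simp
qed

definition C1 where
  "C1 sg sv = {f. Vector_Spaces.linear sv sg f}"

definition C2 where
  "C2 sg sv =
     {f. bilinear_map sv sv sg f \<and> (\<forall>v. f v v = 0)} \<times>
     {g. trilinear_map sv sv sv sg g \<and> (\<forall>v w. g v v w = 0)}"

definition delta1_I where
  "delta1_I br \<rho> T f u v =
     rho_T br \<rho> T u (f v) - rho_T br \<rho> T v (f u) - f (bracket_T \<rho> T u v)"

definition delta1_II where
  "delta1_II br tr \<rho> \<mu> T f u v w =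
     D_T tr \<mu> T u v (f w) + mu_T br tr \<rho> \<mu> T v w (f u) - mu_T br tr \<rho> \<mu> T u w (f v)
     - f (triple_T br \<rho> \<mu> T u v w)"

text \<open>
  In degree 2 an argument \<open>u \<and> v\<close> is passed as the two arguments \<open>u v\<close>, and the term
  \<open>(u\<^sub>1 \<and> v\<^sub>1) \<circ> (u\<^sub>2 \<and> v\<^sub>2)\<close> is expanded by linearity.
\<close>

definition delta2_I where
  "delta2_I br tr \<rho> \<mu> T = (\<lambda>(f, g) u1 v1 u2 v2.
     - rho_T br \<rho> T u2 (g u1 v1 v2) + rho_T br \<rho> T v2 (g u1 v1 u2)
     + g u1 v1 (bracket_T \<rho> T u2 v2)
     + D_T tr \<mu> T u1 v1 (f u2 v2)
     - (f (triple_T br \<rho> \<mu> T u1 v1 u2) v2 + f u2 (triple_T br \<rho> \<mu> T u1 v1 v2)))"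

definition delta2_II where
  "delta2_II br tr \<rho> \<mu> T = (\<lambda>(f, g) u1 v1 u2 v2 w.
     - mu_T br tr \<rho> \<mu> T v2 w (g u1 v1 u2) + mu_T br tr \<rho> \<mu> T u2 w (g u1 v1 v2)
     + D_T tr \<mu> T u1 v1 (g u2 v2 w) - D_T tr \<mu> T u2 v2 (g u1 v1 w)
     - (g (triple_T br \<rho> \<mu> T u1 v1 u2) v2 w + g u2 (triple_T br \<rho> \<mu> T u1 v1 v2) w)
     - g u2 v2 (triple_T br \<rho> \<mu> T u1 v1 w) + g u1 v1 (triple_T br \<rho> \<mu> T u2 v2 w))"

definition Z2 where
  "Z2 sg br tr sv \<rho> \<mu> T =
     {F \<in> C2 sg sv.
        (\<forall>u1 v1 u2 v2. delta2_I br tr \<rho> \<mu> T F u1 v1 u2 v2 = 0) \<and>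
        (\<forall>u1 v1 u2 v2 w. delta2_II br tr \<rho> \<mu> T F u1 v1 u2 v2 w = 0)}"

definition B2 where
  "B2 sg br tr sv \<rho> \<mu> T =
     (\<lambda>f. (delta1_I br \<rho> T f, delta1_II br tr \<rho> \<mu> T f)) ` C1 sg sv"

definition cohomologous where
  "cohomologous sg br tr sv \<rho> \<mu> T =
     {(F, F') \<in> Z2 sg br tr sv \<rho> \<mu> T \<times> Z2 sg br tr sv \<rho> \<mu> T.
        ((\<lambda>u v. fst F u v - fst F' u v), (\<lambda>u v w. snd F u v w - snd F' u v w))
          \<in> B2 sg br tr sv \<rho> \<mu> T}"

definition H2 where
  "H2 sg br tr sv \<rho> \<mu> T = Z2 sg br tr sv \<rho> \<mu> T // cohomologous sg br tr sv \<rho> \<mu> T"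

text \<open>
  The coset is empty when \<open>F\<close> is not a cocycle, hence it lies in \<^const>\<open>H2\<close> exactly if \<open>F\<close> is one.
\<close>

definition cohomology_class where
  "cohomology_class sg br tr sv \<rho> \<mu> T F = cohomologous sg br tr sv \<rho> \<mu> T `` {F}"

definition is_trivial_class where
  "is_trivial_class sg br tr sv \<rho> \<mu> T c \<longleftrightarrow> (\<exists>F\<in>c. F \<in> B2 sg br tr sv \<rho> \<mu> T)"


section \<open>The obstruction\<close>

definition Ob_I where
  "Ob_I br \<rho> n \<TT> v1 v2 =
     (\<Sum>(i, j) \<in> {(i, j). i + j = n + 1 \<and> 1 \<le> i \<and> 1 \<le> j}.
        br (\<TT> i v1) (\<TT> j v2) - \<TT> i (\<rho> (\<TT> j v1) v2 - \<rho> (\<TT> j v2) v1))"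

text \<open>
  The index range is that of all terms of the coefficient of \<open>t\<^sup>n\<^sup>+\<^sup>1\<close> which do not involve
  \<open>\<TT> (n + 1)\<close>, i.e. \<open>i, j, k \<le> n\<close>. For two indices this is the same as \<open>i, j \<ge> 1\<close>. For three
  indices the condition \<open>i, j, k \<ge> 1\<close>, with which the obstruction is also found written, omits the
  terms with exactly one index \<open>0\<close>, and then triviality of the class does not characterise
  extensibility: let \<open>\<gg>\<close> have basis \<open>a, b, c\<close> with \<open>\<lbrakk>a, b, b\<rbrakk> = c = - \<lbrakk>b, a, b\<rbrakk>\<close> and all other
  brackets of basis vectors \<open>0\<close>, let \<open>V\<close> have basis \<open>e, e'\<close> with \<open>\<rho> = 0\<close>, \<open>\<mu> = 0\<close>, and let
  \<open>\<TT> 0 e = a\<close>, \<open>\<TT> 0 e' = 0\<close>, \<open>\<TT> 1 e = 0\<close>, \<open>\<TT> 1 e' = b\<close>. For \<open>n = 1\<close> the range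
  \<open>i, j, k \<ge> 1\<close> is empty, but the deformation is not extensible because of
  \<open>\<lbrakk>\<TT> 0 e, \<TT> 1 e', \<TT> 1 e'\<rbrakk> = c\<close>.
\<close>

definition Ob_II where
  "Ob_II br tr \<rho> \<mu> n \<TT> v1 v2 v3 =
     (\<Sum>(i, j, k) \<in> {(i, j, k). i + j + k = n + 1 \<and> i \<le> n \<and> j \<le> n \<and> k \<le> n}.
        tr (\<TT> i v1) (\<TT> j v2) (\<TT> k v3)
        - \<TT> i (rep_D br \<rho> \<mu> (\<TT> j v1) (\<TT> k v2) v3
                + \<mu> (\<TT> j v2) (\<TT> k v3) v1 - \<mu> (\<TT> j v1) (\<TT> k v3) v2))"

definition Ob where
  "Ob br tr \<rho> \<mu> n \<TT> = (Ob_I br \<rho> n \<TT>, Ob_II br tr \<rho> \<mu> n \<TT>)"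

end

theory Submission
  imports Defs "HOL-Library.Product_Plus"
begin

text \<open>
  For a linear map \<open>T: V \<rightarrow> \<gg>\<close>, let the defects be the differences of the two sides of the two
  Rota-Baxter equations; they vanish exactly if the graph of \<open>T\<close> is a subalgebra of the semidirect
  product \<open>\<gg> \<ltimes> V\<close>. For arbitrary \<open>T\<close> the defects satisfy the cocycle equations with
  respect to \<open>T\<close>. Only additivity of the structure maps is needed for this, so it also applies to
  \<open>T\<^sub>t\<close> acting on polynomials. The defects of a deformation of order \<open>n\<close> are
  \<open>Ob t\<^sup>n\<^sup>+\<^sup>1\<close> up to higher terms, hence the coefficient of \<open>t\<^sup>n\<^sup>+\<^sup>1\<close> in the
  cocycle equations for \<open>T\<^sub>t\<close> says that \<open>Ob\<close> is a cocycle with respect to \<open>T\<close>. Adding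
  \<open>f t\<^sup>n\<^sup>+\<^sup>1\<close> to \<open>T\<^sub>t\<close> changes this leading coefficient by the coboundary of \<open>f\<close>, so
  \<open>T\<^sub>t\<close> is extensible iff \<open>Ob\<close> is the coboundary of some \<open>- f\<close>.
\<close>

section \<open>Additive Lie-Yamaguti representations\<close>

locale biadditive =
  fixes f :: "'a::ab_group_add \<Rightarrow> 'b::ab_group_add \<Rightarrow> 'c::ab_group_add"
  assumes add_left: "f (x + x') y = f x y + f x' y"
    and add_right: "f x (y + y') = f x y + f x y'"
begin

sublocale left: additive "\<lambda>x. f x y" for y
  by standard (rule add_left)

sublocale right: additive "f x" for x
  by standard (rule add_right)

lemmas simps = add_left add_right left.zero right.zero left.minus right.minus left.diff right.diff

end

locale triadditive =
  fixes f :: "'a::ab_group_add \<Rightarrow> 'b::ab_group_add \<Rightarrow> 'c::ab_group_add \<Rightarrow> 'd::ab_group_add"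
  assumes add_left: "f (x + x') y z = f x y z + f x' y z"
    and biadditive: "biadditive (f x)"
begin

sublocale left: additive "\<lambda>x. f x y z" for y z
  by standard (rule add_left)

sublocale rest: biadditive "f x" for x
  by (rule biadditive)

lemmas simps = add_left left.zero left.minus left.diff rest.simps

end

text \<open>Stated for abelian groups, so that the same locale covers the given spaces and their
  polynomials in t. Antisymmetry takes the place of alternation because it is an identity linear in
  each argument, and such identities pass to polynomials by comparing constants.\<close>

locale additive_ly_representation =
  br: biadditive br + tr: triadditive tr + rho: biadditive \<rho> + mu: triadditive \<mu>
  for br :: "'g::ab_group_add \<Rightarrow> 'g \<Rightarrow> 'g"
    and tr :: "'g \<Rightarrow> 'g \<Rightarrow> 'g \<Rightarrow> 'g"
    and \<rho> :: "'g \<Rightarrow> 'v::ab_group_add \<Rightarrow> 'v"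
    and \<mu> :: "'g \<Rightarrow> 'g \<Rightarrow> 'v \<Rightarrow> 'v" +
  assumes br_anti: "br x y = - br y x"
    and tr_anti: "tr x y z = - tr y x z"
    and LY3: "tr x y (br z w) = br (tr x y z) w + br z (tr x y w)"
    and LY4: "tr x y (tr z w t) = tr (tr x y z) w t + tr z (tr x y w) t + tr z w (tr x y t)"
    and rep2: "\<mu> x (br y z) v = \<rho> y (\<mu> x z v) - \<rho> z (\<mu> x y v)"
    and rep3: "\<rho> (tr x y z) v = rep_D br \<rho> \<mu> x y (\<rho> z v) - \<rho> z (rep_D br \<rho> \<mu> x y v)"
    and rep4: "\<mu> x (tr y z w) v
                 = \<mu> z w (\<mu> x y v) - \<mu> y w (\<mu> x z v) + rep_D br \<rho> \<mu> y z (\<mu> x w v)"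
    and rep5: "\<mu> (tr x y z) w v + \<mu> z (tr x y w) v
                 = rep_D br \<rho> \<mu> x y (\<mu> z w v) - \<mu> z w (rep_D br \<rho> \<mu> x y v)"
begin

abbreviation D where "D \<equiv> rep_D br \<rho> \<mu>"

lemma triadditive_D: "triadditive D"
  by unfold_locales (simp_all add: rep_D_def br.simps rho.simps mu.simps algebra_simps)

sublocale D: triadditive D
  by (rule triadditive_D)

lemma D_anti: "D x y v = - D y x v"
proof -
  have "\<rho> (br x y) v = - \<rho> (br y x) v"
    by (subst br_anti) (rule rho.left.minus)
  then show ?thesis
    by (simp add: rep_D_def)
qed

text \<open>Expanding \<open>D z w\<close> by its definition leaves three kinds of terms: rep5
  treats those in \<mu>, rep3 the commutator of \<rho>, and rep3 together with LY3 the term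
  \<open>\<rho> (br z w)\<close>.\<close>

lemma D_derivation: "D x y (D z w v) - D z w (D x y v) = D (tr x y z) w v + D z (tr x y w) v"
proof -
  have mu': "\<mu> z (tr x y w) v = D x y (\<mu> z w v) - \<mu> z w (D x y v) - \<mu> (tr x y z) w v" for z w v
    using rep5[of x y z w v] by (simp add: algebra_simps)
  have "\<rho> (br (tr x y z) w) v + \<rho> (br z (tr x y w)) v = \<rho> (tr x y (br z w)) v"
    by (simp add: LY3 rho.simps)
  also have "\<dots> = D x y (\<rho> (br z w) v) - \<rho> (br z w) (D x y v)"
    by (rule rep3)
  finally have r: "\<rho> (br z (tr x y w)) v
      = D x y (\<rho> (br z w) v) - \<rho> (br z w) (D x y v) - \<rho> (br (tr x y z) w) v"
    by (simp add: algebra_simps)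
  show ?thesis
    unfolding rep_D_def[of br \<rho> \<mu> z w] rep_D_def[of br \<rho> \<mu> "tr x y z" w]
      rep_D_def[of br \<rho> \<mu> z "tr x y w"]
    by (simp add: mu' r rep3 rho.simps D.simps algebra_simps)
qed

section \<open>The semidirect product of the algebra with its representation\<close>

definition semi_br :: "'g \<times> 'v \<Rightarrow> 'g \<times> 'v \<Rightarrow> 'g \<times> 'v" where
  "semi_br X Y = (br (fst X) (fst Y), \<rho> (fst X) (snd Y) - \<rho> (fst Y) (snd X))"

definition semi_tr :: "'g \<times> 'v \<Rightarrow> 'g \<times> 'v \<Rightarrow> 'g \<times> 'v \<Rightarrow> 'g \<times> 'v" where
  "semi_tr X Y Z = (tr (fst X) (fst Y) (fst Z),
     D (fst X) (fst Y) (snd Z) + \<mu> (fst Y) (fst Z) (snd X) - \<mu> (fst X) (fst Z) (snd Y))"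

text \<open>The algebra component is LY3. In the V component, the parts linear in
  \<open>snd Z\<close> and \<open>snd W\<close> are instances of rep3, those linear in
  \<open>snd X\<close> and \<open>snd Y\<close> instances of rep2.\<close>

lemma semi_LY3:
  "semi_tr X Y (semi_br Z W) = semi_br (semi_tr X Y Z) W + semi_br Z (semi_tr X Y W)"
  by (simp add: semi_br_def semi_tr_def prod_eq_iff LY3 rep2 rep3 rho.simps D.simps algebra_simps)

text \<open>The algebra component is LY4. The V component splits in the same way: rep4 for
  \<open>snd X\<close> and \<open>snd Y\<close>, rep5 for \<open>snd Z\<close> and
  \<open>snd W\<close>, and \<open>D_derivation\<close> for \<open>snd U\<close>.\<close>

lemma semi_LY4:
  "semi_tr X Y (semi_tr Z W U)
     = semi_tr (semi_tr X Y Z) W U + semi_tr Z (semi_tr X Y W) U + semi_tr Z W (semi_tr X Y U)"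
proof -
  have d: "D z (tr x y w) v = D x y (D z w v) - D z w (D x y v) - D (tr x y z) w v"
    for x y z w :: 'g and v :: 'v
    using D_derivation[of x y z w v] by (simp add: algebra_simps)
  have m: "\<mu> (tr x y z) w v = D x y (\<mu> z w v) - \<mu> z w (D x y v) - \<mu> z (tr x y w) v"
    for x y z w :: 'g and v :: 'v
    using rep5[of x y z w v] by (simp add: algebra_simps)
  show ?thesis
    using LY4[of "fst X" "fst Y" "fst Z" "fst W" "fst U"]
    by (simp add: semi_tr_def prod_eq_iff d m rep4 mu.simps D.simps algebra_simps)
qed

lemma biadditive_semi_br: "biadditive semi_br"
  by unfold_locales (simp_all add: semi_br_def prod_eq_iff br.simps rho.simps algebra_simps)

lemma triadditive_semi_tr: "triadditive semi_tr"
  by unfold_locales (simp_all add: semi_tr_def prod_eq_iff tr.simps mu.simps D.simps algebra_simps)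

lemma semi_br_anti: "semi_br X Y = - semi_br Y X"
  using br_anti[of "fst X" "fst Y"] by (simp add: semi_br_def prod_eq_iff)

lemma semi_tr_anti: "semi_tr X Y Z = - semi_tr Y X Z"
  using tr_anti[of "fst X" "fst Y" "fst Z"] D_anti[of "fst X" "fst Y" "snd Z"]
  by (simp add: semi_tr_def prod_eq_iff)

end

section \<open>The defects of an additive map and their cocycle identities\<close>

definition rb_defect2 where
  "rb_defect2 br \<rho> T u v = br (T u) (T v) - T (bracket_T \<rho> T u v)"

definition rb_defect3 where
  "rb_defect3 br tr \<rho> \<mu> T u v w = tr (T u) (T v) (T w) - T (triple_T br \<rho> \<mu> T u v w)"

locale additive_ly_representation_map =
  additive_ly_representation br tr \<rho> \<mu> + T: additive T
  for br :: "'g::ab_group_add \<Rightarrow> 'g \<Rightarrow> 'g"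
    and tr :: "'g \<Rightarrow> 'g \<Rightarrow> 'g \<Rightarrow> 'g"
    and \<rho> :: "'g \<Rightarrow> 'v::ab_group_add \<Rightarrow> 'v"
    and \<mu> :: "'g \<Rightarrow> 'g \<Rightarrow> 'v \<Rightarrow> 'v"
    and T :: "'v \<Rightarrow> 'g"
begin

abbreviation E2 where "E2 \<equiv> rb_defect2 br \<rho> T"
abbreviation E3 where "E3 \<equiv> rb_defect3 br tr \<rho> \<mu> T"

text \<open>Applied to \<open>T\<^sub>t\<close> and read off at a single coefficient, this and the
  next lemma make the obstruction alternating.\<close>

lemma defect2_anti: "E2 u v = - E2 v u"
proof -
  have "bracket_T \<rho> T u v = - bracket_T \<rho> T v u"
    by (simp add: bracket_T_def)
  then show ?thesis
    using br_anti[of "T u" "T v"] by (simp add: rb_defect2_def T.minus)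
qed

lemma defect3_anti: "E3 u v w = - E3 v u w"
proof -
  have "triple_T br \<rho> \<mu> T u v w = - triple_T br \<rho> \<mu> T v u w"
    using D_anti[of "T u" "T v" w] by (simp add: triple_T_def)
  then show ?thesis
    using tr_anti[of "T u" "T v" "T w"] by (simp add: rb_defect3_def T.minus)
qed

text \<open>The graph of T is a complement of the copy \<open>incl\<close> of the algebra in the
  semidirect product, and \<open>proj\<close> is the projection onto that copy with the graph as
  kernel.\<close>

definition graph :: "'v \<Rightarrow> 'g \<times> 'v" where "graph u = (T u, u)"

definition incl :: "'g \<Rightarrow> 'g \<times> 'v" where "incl x = (x, 0)"

definition proj :: "'g \<times> 'v \<Rightarrow> 'g" where "proj X = fst X - T (snd X)"

lemma proj_add: "proj (X + Y) = proj X + proj Y"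
  by (simp add: proj_def T.add)

lemma proj_minus: "proj (- X) = - proj X"
  by (simp add: proj_def T.minus)

lemma semi_br_graph: "semi_br (graph u) (graph v) = graph (bracket_T \<rho> T u v) + incl (E2 u v)"
  by (simp add: semi_br_def graph_def incl_def rb_defect2_def bracket_T_def)

lemma semi_tr_graph:
  "semi_tr (graph u) (graph v) (graph w) = graph (triple_T br \<rho> \<mu> T u v w) + incl (E3 u v w)"
  by (simp add: semi_tr_def graph_def incl_def rb_defect3_def triple_T_def)

lemma proj_graph: "proj (graph u) = 0"
  by (simp add: proj_def graph_def)

lemma proj_incl: "proj (incl x) = x"
  by (simp add: proj_def incl_def T.zero)

text \<open>If the graph is a subalgebra, it acts on the quotient of the semidirect product by it,
  which \<open>proj\<close> identifies with the algebra. The operators \<open>rho_T\<close>,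
  \<open>D_T\<close> and \<open>mu_T\<close> are this action; the formulas hold for every additive
  T.\<close>

lemma proj_semi_br: "proj (semi_br (graph u) (incl x)) = rho_T br \<rho> T u x"
  by (simp add: proj_def semi_br_def graph_def incl_def rho_T_def rho.simps T.minus)

lemma proj_semi_tr:
  "proj (semi_tr (graph u) (graph v) (incl x)) = D_T tr \<mu> T u v x"
  "proj (semi_tr (incl x) (graph u) (graph v)) = mu_T br tr \<rho> \<mu> T u v x"
  by (simp_all add: proj_def semi_tr_def graph_def incl_def D_T_def mu_T_def D.simps mu.simps)

lemma proj_semi_flip:
  "proj (semi_br (incl x) (graph u)) = - rho_T br \<rho> T u x"
  "proj (semi_tr (graph u) (incl x) (graph v)) = - mu_T br tr \<rho> \<mu> T u v x"
  by (simp_all add: semi_br_anti[of "incl x"] semi_tr_anti[of "graph u" "incl x"]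
      proj_minus proj_semi_br proj_semi_tr)

text \<open>
  These two identities are the last two Lie-Yamaguti axioms of the semidirect product at points of
  the graph of \<open>T\<close>, projected to \<open>\<gg>\<close> along the graph.
\<close>

lemma delta2_I_defect: "delta2_I br tr \<rho> \<mu> T (E2, E3) u1 v1 u2 v2 = 0"
proof -
  interpret s2: biadditive semi_br by (rule biadditive_semi_br)
  interpret s3: triadditive semi_tr by (rule triadditive_semi_tr)
  have "proj (semi_tr (graph u1) (graph v1) (semi_br (graph u2) (graph v2)))
      = proj (semi_br (semi_tr (graph u1) (graph v1) (graph u2)) (graph v2)
              + semi_br (graph u2) (semi_tr (graph u1) (graph v1) (graph v2)))"
    by (rule arg_cong[OF semi_LY3])
  \<comment> \<open>Each inner product is a graph point plus an included defect. Under
    \<open>proj\<close>, products of graph points alone contribute a defect, and products with one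
    included defect contribute an operator applied to it.\<close>
  then have "E3 u1 v1 (bracket_T \<rho> T u2 v2) + D_T tr \<mu> T u1 v1 (E2 u2 v2)
      = E2 (triple_T br \<rho> \<mu> T u1 v1 u2) v2 - rho_T br \<rho> T v2 (E3 u1 v1 u2)
        + (E2 u2 (triple_T br \<rho> \<mu> T u1 v1 v2) + rho_T br \<rho> T u2 (E3 u1 v1 v2))"
    by (simp add: semi_br_graph semi_tr_graph s2.simps s3.simps proj_add proj_graph
        proj_incl proj_semi_br proj_semi_tr proj_semi_flip)
  then show ?thesis
    by (simp add: delta2_I_def algebra_simps)
qed

lemma delta2_II_defect: "delta2_II br tr \<rho> \<mu> T (E2, E3) u1 v1 u2 v2 w = 0"
proof -
  interpret s3: triadditive semi_tr by (rule triadditive_semi_tr)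
  have "proj (semi_tr (graph u1) (graph v1) (semi_tr (graph u2) (graph v2) (graph w)))
      = proj (semi_tr (semi_tr (graph u1) (graph v1) (graph u2)) (graph v2) (graph w)
              + semi_tr (graph u2) (semi_tr (graph u1) (graph v1) (graph v2)) (graph w)
              + semi_tr (graph u2) (graph v2) (semi_tr (graph u1) (graph v1) (graph w)))"
    by (rule arg_cong[OF semi_LY4])
  then have "E3 u1 v1 (triple_T br \<rho> \<mu> T u2 v2 w) + D_T tr \<mu> T u1 v1 (E3 u2 v2 w)
      = E3 (triple_T br \<rho> \<mu> T u1 v1 u2) v2 w + mu_T br tr \<rho> \<mu> T v2 w (E3 u1 v1 u2)
        + (E3 u2 (triple_T br \<rho> \<mu> T u1 v1 v2) w - mu_T br tr \<rho> \<mu> T u2 w (E3 u1 v1 v2))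
        + (E3 u2 v2 (triple_T br \<rho> \<mu> T u1 v1 w) + D_T tr \<mu> T u2 v2 (E3 u1 v1 w))"
    by (simp add: semi_tr_graph s3.simps proj_add proj_graph proj_incl proj_semi_tr
        proj_semi_flip)
  then show ?thesis
    by (simp add: delta2_II_def algebra_simps)
qed

end

section \<open>Extension to polynomials\<close>

text \<open>Since \<open>pCons 0\<close> is multiplication by t, these are the maps linear over the
  integer polynomials in t. Every polynomial arises from constants by sums and multiplication by t,
  so such a map is determined by its values on constants.\<close>

definition t_linear :: "('a::ab_group_add poly \<Rightarrow> 'b::ab_group_add poly) \<Rightarrow> bool" where
  "t_linear F \<longleftrightarrow> (\<forall>p q. F (p + q) = F p + F q) \<and> (\<forall>p. F (pCons 0 p) = pCons 0 (F p))"

lemma t_linearD: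
  assumes "t_linear F"
  shows "additive F" "F (pCons 0 p) = pCons 0 (F p)"
  using assms by (simp_all add: t_linear_def additive_def)

lemma t_linear_pCons:
  assumes "t_linear F"
  shows "F (pCons a p) = F [:a:] + pCons 0 (F p)"
proof -
  have "F ([:a:] + pCons 0 p) = F [:a:] + pCons 0 (F p)"
    using assms unfolding t_linear_def by metis
  then show ?thesis by simp
qed

lemma t_linear_id: "t_linear (\<lambda>p. p)"
  by (simp add: t_linear_def)

lemma t_linear_add: "t_linear F \<Longrightarrow> t_linear G \<Longrightarrow> t_linear (\<lambda>p. F p + G p)"
  by (simp add: t_linear_def algebra_simps)

lemma t_linear_diff: "t_linear F \<Longrightarrow> t_linear G \<Longrightarrow> t_linear (\<lambda>p. F p - G p)"
  by (simp add: t_linear_def algebra_simps)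

lemma t_linear_compose: "t_linear G \<Longrightarrow> t_linear F \<Longrightarrow> t_linear (\<lambda>p. G (F p))"
  by (simp add: t_linear_def)

lemma t_linear_eq0:
  assumes F: "t_linear F" and const: "\<And>a. F [:a:] = 0"
  shows "F p = 0"
proof (induction p)
  case 0
  show ?case using t_linearD(1)[OF F] by (rule additive.zero)
next
  case (pCons a p)
  then show ?case by (simp add: t_linear_pCons[OF F, of a p] const)
qed

text \<open>The arguments are reduced to constants one at a time. This lemma and the next three
  serve to transfer the axioms, which have two to five arguments.\<close>

lemma t_linear_eq0_2:
  assumes "\<And>q. t_linear (\<lambda>p. F p q)" "\<And>p. t_linear (F p)"
    and "\<And>a b. F [:a:] [:b:] = 0"
  shows "F p q = 0"
  by (rule t_linear_eq0[OF assms(1)], rule t_linear_eq0[OF assms(2)], rule assms(3))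

lemma t_linear_eq0_3:
  assumes "\<And>q r. t_linear (\<lambda>p. F p q r)" "\<And>p r. t_linear (\<lambda>q. F p q r)" "\<And>p q. t_linear (F p q)"
    and "\<And>a b c. F [:a:] [:b:] [:c:] = 0"
  shows "F p q r = 0"
  by (rule t_linear_eq0[OF assms(1)], rule t_linear_eq0_2[where F = "F [:a:]" for a])
    (rule assms)+

lemma t_linear_eq0_4:
  assumes "\<And>q r s. t_linear (\<lambda>p. F p q r s)" "\<And>p r s. t_linear (\<lambda>q. F p q r s)"
    "\<And>p q s. t_linear (\<lambda>r. F p q r s)" "\<And>p q r. t_linear (F p q r)"
    and "\<And>a b c d. F [:a:] [:b:] [:c:] [:d:] = 0"
  shows "F p q r s = 0"
  by (rule t_linear_eq0[OF assms(1)], rule t_linear_eq0_3[where F = "F [:a:]" for a])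
    (rule assms)+

lemma t_linear_eq0_5:
  assumes "\<And>q r s t. t_linear (\<lambda>p. F p q r s t)" "\<And>p r s t. t_linear (\<lambda>q. F p q r s t)"
    "\<And>p q s t. t_linear (\<lambda>r. F p q r s t)" "\<And>p q r t. t_linear (\<lambda>s. F p q r s t)"
    "\<And>p q r s. t_linear (F p q r s)"
    and "\<And>a b c d e. F [:a:] [:b:] [:c:] [:d:] [:e:] = 0"
  shows "F p q r s t = 0"
  by (rule t_linear_eq0[OF assms(1)], rule t_linear_eq0_4[where F = "F [:a:]" for a])
    (rule assms)+

section \<open>Coefficients and linearity of the extended maps\<close>

context biadditive
begin

text \<open>Beyond the degrees the coefficients are 0 and f vanishes on them, so the degree bounds
  can be traded for the range of the Cauchy product.\<close>

lemma coeff_ext2: "coeff (ext2 f p q) m = (\<Sum>i\<le>m. f (coeff p i) (coeff q (m - i)))"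
proof -
  have inner: "(\<Sum>j\<le>degree q. if i + j = m then f (coeff p i) (coeff q j) else 0)
      = (if i \<le> m then f (coeff p i) (coeff q (m - i)) else 0)" for i
  proof (cases "i \<le> m")
    case True
    have "(\<Sum>j\<le>degree q. if i + j = m then f (coeff p i) (coeff q j) else 0)
        = (\<Sum>j\<le>degree q. if j = m - i then f (coeff p i) (coeff q j) else 0)"
      using True by (intro sum.cong) auto
    also have "\<dots> = f (coeff p i) (coeff q (m - i))"
      by (auto simp: sum.delta coeff_eq_0 simps)
    finally show ?thesis using True by simp
  qed auto
  have "coeff (ext2 f p q) m
      = (\<Sum>i\<le>degree p. if i \<le> m then f (coeff p i) (coeff q (m - i)) else 0)"
    by (simp add: ext2_def coeff_sum inner)
  also have "\<dots> = (\<Sum>i\<in>{..degree p} \<inter> {..m}. f (coeff p i) (coeff q (m - i)))"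
    by (subst sum.inter_restrict) simp_all
  also have "\<dots> = (\<Sum>i\<le>m. f (coeff p i) (coeff q (m - i)))"
    by (rule sum.mono_neutral_left) (auto simp: simps intro!: le_degree)
  finally show ?thesis .
qed

lemma coeff_ext2_const: "coeff (ext2 f p [:b:]) k = f (coeff p k) b"
proof -
  have "coeff (ext2 f p [:b:]) k = (\<Sum>i\<le>k. if i = k then f (coeff p k) b else 0)"
    unfolding coeff_ext2 by (rule sum.cong) (auto simp: simps coeff_pCons split: nat.split)
  then show ?thesis by simp
qed

lemma ext2_const: "ext2 f [:a:] [:b:] = [:f a b:]"
  by (simp add: ext2_def monom_0)

lemma t_linear_ext2: "t_linear (\<lambda>p. ext2 f p q)" "t_linear (ext2 f p)"
proof -
  have "coeff (ext2 f (pCons 0 p) q) k = coeff (pCons 0 (ext2 f p q)) k" for p q k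
    by (cases k) (simp_all add: coeff_ext2 simps sum.atMost_Suc_shift del: sum.atMost_Suc)
  moreover have "coeff (ext2 f p (pCons 0 q)) k = coeff (pCons 0 (ext2 f p q)) k" for p q k
    by (cases k) (auto simp: coeff_ext2 simps Suc_diff_le intro!: sum.cong)
  ultimately show "t_linear (\<lambda>p. ext2 f p q)" "t_linear (ext2 f p)"
    by (auto simp: t_linear_def poly_eq_iff coeff_ext2 simps sum.distrib)
qed

lemma biadditive_ext2: "biadditive (ext2 f)"
  using t_linear_ext2 by (simp add: biadditive_def t_linear_def)

end

context triadditive
begin

text \<open>Splitting off the first index leaves coefficients of a bilinear extension, so that the
  results on \<open>ext2\<close> can be reused.\<close>

lemma coeff_ext3: "coeff (ext3 f p q r) m = (\<Sum>i\<le>m. coeff (ext2 (f (coeff p i)) q r) (m - i))"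
proof -
  have inner: "(\<Sum>j\<le>degree q. \<Sum>k\<le>degree r.
        coeff (monom (f (coeff p i) (coeff q j) (coeff r k)) (i + j + k)) m)
      = (if i \<le> m then coeff (ext2 (f (coeff p i)) q r) (m - i) else 0)" for i
  proof (cases "i \<le> m")
    case True
    then have "i + j + k = m \<longleftrightarrow> j + k = m - i" for j k
      by linarith
    then show ?thesis
      using True by (simp add: ext2_def coeff_sum)
  qed simp
  have "coeff (ext3 f p q r) m
      = (\<Sum>i\<le>degree p. if i \<le> m then coeff (ext2 (f (coeff p i)) q r) (m - i) else 0)"
    by (simp only: ext3_def coeff_sum inner)
  also have "\<dots> = (\<Sum>i\<in>{..degree p} \<inter> {..m}. coeff (ext2 (f (coeff p i)) q r) (m - i))"
    by (subst sum.inter_restrict) simp_all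
  also have "\<dots> = (\<Sum>i\<le>m. coeff (ext2 (f (coeff p i)) q r) (m - i))"
    by (rule sum.mono_neutral_left) (auto simp: simps rest.coeff_ext2 intro!: le_degree)
  finally show ?thesis .
qed

lemma ext3_const: "ext3 f [:a:] [:b:] [:c:] = [:f a b c:]"
  by (simp add: ext3_def monom_0)

lemma t_linear_ext3:
  "t_linear (\<lambda>p. ext3 f p q r)" "t_linear (\<lambda>q. ext3 f p q r)" "t_linear (ext3 f p q)"
proof -
  \<comment> \<open>Multiplication by t passes through the Cauchy sum: the term i = k is the
    constant coefficient of a multiple of t, hence 0.\<close>
  have conv: "(\<Sum>i\<le>k. coeff (pCons 0 (g i)) (k - i)) = coeff (pCons 0 s) k"
    if "\<And>k. coeff s k = (\<Sum>i\<le>k. coeff (g i) (k - i))" for g :: "nat \<Rightarrow> 'd poly" and s k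
    by (cases k) (auto simp: that Suc_diff_le intro!: sum.cong)
  have "coeff (ext3 f (pCons 0 p) q r) k = coeff (pCons 0 (ext3 f p q r)) k" for p q r k
    by (cases k)
      (simp_all add: coeff_ext3 simps rest.coeff_ext2 sum.atMost_Suc_shift del: sum.atMost_Suc)
  moreover have "coeff (ext3 f p (pCons 0 q) r) k = coeff (pCons 0 (ext3 f p q r)) k" for p q r k
    unfolding coeff_ext3 t_linearD(2)[OF rest.t_linear_ext2(1)] by (rule conv) (rule coeff_ext3)
  moreover have "coeff (ext3 f p q (pCons 0 r)) k = coeff (pCons 0 (ext3 f p q r)) k" for p q r k
    unfolding coeff_ext3 t_linearD(2)[OF rest.t_linear_ext2(2)] by (rule conv) (rule coeff_ext3)
  ultimately show "t_linear (\<lambda>p. ext3 f p q r)" "t_linear (\<lambda>q. ext3 f p q r)"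
    "t_linear (ext3 f p q)"
    by (auto simp: t_linear_def poly_eq_iff coeff_ext3 rest.coeff_ext2 simps sum.distrib)
qed

lemma triadditive_ext3: "triadditive (ext3 f)"
  using t_linear_ext3 by (simp add: triadditive_def biadditive_def t_linear_def)

end

section \<open>The representation on polynomials\<close>

context additive_ly_representation
begin

lemmas ext_const = br.ext2_const tr.ext3_const rho.ext2_const mu.ext3_const D.ext3_const

lemmas t_linear_ext =
  br.t_linear_ext2 tr.t_linear_ext3 rho.t_linear_ext2 mu.t_linear_ext3 D.t_linear_ext3

lemmas t_linear_intros =
  t_linear_id t_linear_add t_linear_diff t_linear_ext[THEN t_linear_compose]

text \<open>Both sides are linear over t in each argument and agree on constants. Thus the operator
  D of the polynomial representation is the extension of D that occurs in the deformation
  equations.\<close>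

lemma rep_D_ext: "rep_D (ext2 br) (ext2 \<rho>) (ext3 \<mu>) p q r = ext3 D p q r"
proof -
  have "rep_D (ext2 br) (ext2 \<rho>) (ext3 \<mu>) p q r - ext3 D p q r = 0"
    unfolding rep_D_def[of "ext2 br"]
    by (rule t_linear_eq0_3[where F = "\<lambda>p q r.
        ext3 \<mu> q p r - ext3 \<mu> p q r + (ext2 \<rho> p (ext2 \<rho> q r) - ext2 \<rho> q (ext2 \<rho> p r))
        - ext2 \<rho> (ext2 br p q) r - ext3 D p q r"])
      (intro t_linear_intros | simp add: ext_const rep_D_def)+
  then show ?thesis by simp
qed

lemma ext_additive_ly_representation:
  "additive_ly_representation (ext2 br) (ext3 tr) (ext2 \<rho>) (ext3 \<mu>)"
proof (intro additive_ly_representation.intro additive_ly_representation_axioms.intro;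
    (unfold rep_D_ext)?)
  fix x y z w t :: "'g poly" and v :: "'v poly"
  \<comment> \<open>Antisymmetry is put as a vanishing sum because \<open>t_linear_intros\<close>
    covers sums and differences, but not negation.\<close>
  have anti: "br a b + br b a = 0" "tr a b c + tr b a c = 0" for a b c
    using br_anti[of a b] tr_anti[of a b c] by simp_all
  have "ext2 br x y + ext2 br y x = 0"
    by (rule t_linear_eq0_2[where F = "\<lambda>x y. ext2 br x y + ext2 br y x"];
        (intro t_linear_intros)?)
      (simp add: ext_const anti)
  then show "ext2 br x y = - ext2 br y x"
    by (simp add: eq_neg_iff_add_eq_0)
  have "ext3 tr x y z + ext3 tr y x z = 0"
    by (rule t_linear_eq0_3[where F = "\<lambda>x y z. ext3 tr x y z + ext3 tr y x z"];
        (intro t_linear_intros)?)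
      (simp add: ext_const anti)
  then show "ext3 tr x y z = - ext3 tr y x z"
    by (simp add: eq_neg_iff_add_eq_0)
  have "ext3 tr x y (ext2 br z w)
      - (ext2 br (ext3 tr x y z) w + ext2 br z (ext3 tr x y w)) = 0"
    by (rule t_linear_eq0_4[where F = "\<lambda>x y z w. ext3 tr x y (ext2 br z w)
          - (ext2 br (ext3 tr x y z) w + ext2 br z (ext3 tr x y w))"];
        (intro t_linear_intros)?)
      (simp add: ext_const LY3)
  then show "ext3 tr x y (ext2 br z w) = ext2 br (ext3 tr x y z) w + ext2 br z (ext3 tr x y w)"
    by simp
  have "ext3 tr x y (ext3 tr z w t) - (ext3 tr (ext3 tr x y z) w t
      + ext3 tr z (ext3 tr x y w) t + ext3 tr z w (ext3 tr x y t)) = 0"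
    by (rule t_linear_eq0_5[where F = "\<lambda>x y z w t. ext3 tr x y (ext3 tr z w t)
          - (ext3 tr (ext3 tr x y z) w t + ext3 tr z (ext3 tr x y w) t
            + ext3 tr z w (ext3 tr x y t))"];
        (intro t_linear_intros)?)
      (simp add: ext_const, rule LY4)
  then show "ext3 tr x y (ext3 tr z w t) = ext3 tr (ext3 tr x y z) w t
      + ext3 tr z (ext3 tr x y w) t + ext3 tr z w (ext3 tr x y t)"
    by simp
  have "ext3 \<mu> x (ext2 br y z) v - (ext2 \<rho> y (ext3 \<mu> x z v) - ext2 \<rho> z (ext3 \<mu> x y v)) = 0"
    by (rule t_linear_eq0_4[where F = "\<lambda>x y z v. ext3 \<mu> x (ext2 br y z) v
          - (ext2 \<rho> y (ext3 \<mu> x z v) - ext2 \<rho> z (ext3 \<mu> x y v))"];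
        (intro t_linear_intros)?)
      (simp add: ext_const rep2)
  then show "ext3 \<mu> x (ext2 br y z) v = ext2 \<rho> y (ext3 \<mu> x z v) - ext2 \<rho> z (ext3 \<mu> x y v)"
    by simp
  have "ext2 \<rho> (ext3 tr x y z) v
      - (ext3 D x y (ext2 \<rho> z v) - ext2 \<rho> z (ext3 D x y v)) = 0"
    by (rule t_linear_eq0_4[where F = "\<lambda>x y z v. ext2 \<rho> (ext3 tr x y z) v
          - (ext3 D x y (ext2 \<rho> z v) - ext2 \<rho> z (ext3 D x y v))"];
        (intro t_linear_intros)?)
      (simp add: ext_const rep3)
  then show "ext2 \<rho> (ext3 tr x y z) v = ext3 D x y (ext2 \<rho> z v) - ext2 \<rho> z (ext3 D x y v)"
    by simp
  have "ext3 \<mu> x (ext3 tr y z w) v - (ext3 \<mu> z w (ext3 \<mu> x y v)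
      - ext3 \<mu> y w (ext3 \<mu> x z v) + ext3 D y z (ext3 \<mu> x w v)) = 0"
    by (rule t_linear_eq0_5[where F = "\<lambda>x y z w v. ext3 \<mu> x (ext3 tr y z w) v
          - (ext3 \<mu> z w (ext3 \<mu> x y v) - ext3 \<mu> y w (ext3 \<mu> x z v)
            + ext3 D y z (ext3 \<mu> x w v))"];
        (intro t_linear_intros)?)
      (simp add: ext_const rep4)
  then show "ext3 \<mu> x (ext3 tr y z w) v = ext3 \<mu> z w (ext3 \<mu> x y v)
      - ext3 \<mu> y w (ext3 \<mu> x z v) + ext3 D y z (ext3 \<mu> x w v)"
    by simp
  have "ext3 \<mu> (ext3 tr x y z) w v + ext3 \<mu> z (ext3 tr x y w) v
      - (ext3 D x y (ext3 \<mu> z w v) - ext3 \<mu> z w (ext3 D x y v)) = 0"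
    by (rule t_linear_eq0_5[where F = "\<lambda>x y z w v.
          ext3 \<mu> (ext3 tr x y z) w v + ext3 \<mu> z (ext3 tr x y w) v
          - (ext3 D x y (ext3 \<mu> z w v) - ext3 \<mu> z w (ext3 D x y v))"];
        (intro t_linear_intros)?)
      (simp add: ext_const rep5)
  then show "ext3 \<mu> (ext3 tr x y z) w v + ext3 \<mu> z (ext3 tr x y w) v
      = ext3 D x y (ext3 \<mu> z w v) - ext3 \<mu> z w (ext3 D x y v)"
    by simp
qed (rule br.biadditive_ext2 tr.triadditive_ext3 rho.biadditive_ext2 mu.triadditive_ext3)+

end

section \<open>Leading coefficients\<close>

text \<open>\<open>jet m p q x\<close> expresses \<open>p = q + x t\<^sup>m\<close> modulo \<open>t\<^sup>m\<^sup>+\<^sup>1\<close>.\<close>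

definition jet :: "nat \<Rightarrow> 'a::ab_group_add poly \<Rightarrow> 'a poly \<Rightarrow> 'a \<Rightarrow> bool" where
  "jet m p q x \<longleftrightarrow> (\<forall>k<m. coeff p k = coeff q k) \<and> coeff p m = coeff q m + x"

lemma jet_refl: "jet m p p 0"
  by (simp add: jet_def)

lemma jet_trans: "jet m p q x \<Longrightarrow> jet m q r y \<Longrightarrow> jet m p r (y + x)"
  by (simp add: jet_def)

lemma jet_add: "jet m p p' x \<Longrightarrow> jet m q q' y \<Longrightarrow> jet m (p + q) (p' + q') (x + y)"
  by (simp add: jet_def)

lemma jet_diff: "jet m p p' x \<Longrightarrow> jet m q q' y \<Longrightarrow> jet m (p - q) (p' - q') (x - y)"
  by (simp add: jet_def)

text \<open>By additivity only p - q matters. It is x t^m up to higher powers, and F commutes with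
  multiplication by t, so the induction on m strips one factor t at a time.\<close>

lemma jet_t_linear:
  assumes F: "t_linear F" and "jet m p q x"
  shows "jet m (F p) (F q) (coeff (F [:x:]) 0)"
proof -
  have "jet m (F r) 0 (coeff (F [:x:]) 0)" if "jet m r 0 x" for r
    using that
  proof (induction m arbitrary: r)
    case 0
    obtain s where "r = pCons x s"
      using 0 by (cases r) (auto simp: jet_def)
    then show ?case by (simp add: jet_def t_linear_pCons[OF F, of x s])
  next
    case (Suc m)
    obtain s where "r = pCons 0 s"
      using Suc.prems by (cases r) (force simp: jet_def)
    moreover from this have "jet m s 0 x"
      using Suc.prems by (force simp: jet_def)
    ultimately show ?case
      using Suc.IH[of s] by (auto simp: jet_def t_linearD(2)[OF F] less_Suc_eq_0_disj)
  qed
  moreover have "jet m (p - q) 0 x"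
    using assms(2) by (simp add: jet_def)
  ultimately have "jet m (F p - F q) 0 (coeff (F [:x:]) 0)"
    using additive.diff[OF t_linearD(1)[OF F], of p q] by metis
  then show ?thesis by (simp add: jet_def algebra_simps)
qed

text \<open>The nonconstant part of p is a multiple of t; its image is shifted beyond t^m and leaves
  only the constant coefficient of p.\<close>

lemma jet_t_linear_of_const:
  assumes F: "t_linear F" and const: "\<And>a. jet m (F [:a:]) 0 (g a)"
  shows "jet m (F p) 0 (g (coeff p 0))"
proof (induction p)
  case 0
  show ?case using const[of 0] by simp
next
  case (pCons a p)
  have "jet m (F [:a:] + pCons 0 (F p)) (0 + 0) (g a + 0)"
    using pCons.IH by (intro jet_add const) (auto simp: jet_def coeff_pCons split: nat.split)
  then show ?case by (simp add: t_linear_pCons[OF F, of a p])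
qed

text \<open>A product rule. The arguments are replaced one after the other, which explains the
  mixture of \<open>coeff p' 0\<close> and \<open>coeff q 0\<close> and keeps the rule correct for m
  = 0.\<close>

lemma (in biadditive) jet_ext2:
  assumes "jet m p p' x" "jet m q q' y"
  shows "jet m (ext2 f p q) (ext2 f p' q') (f (coeff p' 0) y + f x (coeff q 0))"
  using jet_trans[OF jet_t_linear[OF t_linear_ext2(1) assms(1), of q]
      jet_t_linear[OF t_linear_ext2(2) assms(2), of p']]
  by (simp add: coeff_ext2)

lemma (in triadditive) jet_ext3:
  assumes "jet m p p' x" "jet m q q' y" "jet m r r' z"
  shows "jet m (ext3 f p q r) (ext3 f p' q' r')
    (f (coeff p' 0) (coeff q' 0) z + f (coeff p' 0) y (coeff r 0) + f x (coeff q 0) (coeff r 0))"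
  using jet_trans[OF jet_t_linear[OF t_linear_ext3(1) assms(1), of q r]
      jet_trans[OF jet_t_linear[OF t_linear_ext3(2) assms(2), of p' r]
        jet_t_linear[OF t_linear_ext3(3) assms(3), of p' q']]]
  by (simp add: coeff_ext3 rest.coeff_ext2)

section \<open>Deformations and their obstruction\<close>

text \<open>The values of \<open>\<TT>\<close> beyond n, which a deformation leaves open, are taken
  to be 0, so that the coefficients of \<open>T\<^sub>t\<close> are Cauchy sums without a cutoff at
  n.\<close>

locale additive_ly_representation_family =
  additive_ly_representation br tr \<rho> \<mu>
  for br :: "'g::ab_group_add \<Rightarrow> 'g \<Rightarrow> 'g"
    and tr :: "'g \<Rightarrow> 'g \<Rightarrow> 'g \<Rightarrow> 'g"
    and \<rho> :: "'g \<Rightarrow> 'v::ab_group_add \<Rightarrow> 'v"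
    and \<mu> :: "'g \<Rightarrow> 'g \<Rightarrow> 'v \<Rightarrow> 'v" +
  fixes n :: nat and \<TT> :: "nat \<Rightarrow> 'v \<Rightarrow> 'g"
  assumes additive_\<TT>: "additive (\<TT> i)"
    and beyond: "n < i \<Longrightarrow> \<TT> i v = 0"
begin

lemmas \<TT>_simps =
  additive.add[OF additive_\<TT>] additive.zero[OF additive_\<TT>] additive.minus[OF additive_\<TT>]
  additive.diff[OF additive_\<TT>]

abbreviation "T\<^sub>t \<equiv> deformation_map \<TT> n"

lemma coeff_T\<^sub>t: "coeff (T\<^sub>t p) k = (\<Sum>i\<le>k. \<TT> i (coeff p (k - i)))"
proof -
  have inner: "(\<Sum>j\<le>degree p. if i + j = k then \<TT> i (coeff p j) else 0)
      = (if i \<le> k then \<TT> i (coeff p (k - i)) else 0)" for i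
  proof (cases "i \<le> k")
    case True
    have "(\<Sum>j\<le>degree p. if i + j = k then \<TT> i (coeff p j) else 0)
        = (\<Sum>j\<le>degree p. if j = k - i then \<TT> i (coeff p j) else 0)"
      using True by (intro sum.cong) auto
    also have "\<dots> = \<TT> i (coeff p (k - i))"
      by (auto simp: coeff_eq_0 \<TT>_simps)
    finally show ?thesis using True by simp
  qed auto
  have "coeff (T\<^sub>t p) k = (\<Sum>i\<le>n. if i \<le> k then \<TT> i (coeff p (k - i)) else 0)"
    by (simp add: deformation_map_def coeff_sum inner)
  also have "\<dots> = (\<Sum>i\<in>{..n} \<inter> {..k}. \<TT> i (coeff p (k - i)))"
    by (subst sum.inter_restrict) simp_all
  also have "\<dots> = (\<Sum>i\<le>k. \<TT> i (coeff p (k - i)))"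
    by (rule sum.mono_neutral_left) (auto intro!: beyond)
  finally show ?thesis .
qed

lemma coeff_T\<^sub>t_const: "coeff (T\<^sub>t [:v:]) k = \<TT> k v"
proof -
  have "coeff (T\<^sub>t [:v:]) k = (\<Sum>i\<le>k. if i = k then \<TT> k v else 0)"
    unfolding coeff_T\<^sub>t by (rule sum.cong) (auto simp: \<TT>_simps coeff_pCons split: nat.split)
  then show ?thesis by simp
qed

lemma t_linear_T\<^sub>t: "t_linear T\<^sub>t"
proof -
  have "coeff (T\<^sub>t (pCons 0 p)) k = coeff (pCons 0 (T\<^sub>t p)) k" for p k
    by (cases k) (auto simp: coeff_T\<^sub>t \<TT>_simps Suc_diff_le intro!: sum.cong)
  then show ?thesis
    by (auto simp: t_linear_def poly_eq_iff coeff_T\<^sub>t \<TT>_simps sum.distrib)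
qed

sublocale ext: additive_ly_representation_map "ext2 br" "ext3 tr" "ext2 \<rho>" "ext3 \<mu>" T\<^sub>t
  by (intro additive_ly_representation_map.intro ext_additive_ly_representation
      t_linearD(1)[OF t_linear_T\<^sub>t])

lemmas t_linear_intros' = t_linear_intros t_linear_compose[OF t_linear_T\<^sub>t]

lemma t_linear_ops:
  "t_linear (rho_T (ext2 br) (ext2 \<rho>) T\<^sub>t p)"
  "t_linear (mu_T (ext2 br) (ext3 tr) (ext2 \<rho>) (ext3 \<mu>) T\<^sub>t p q)"
  "t_linear (D_T (ext3 tr) (ext3 \<mu>) T\<^sub>t p q)"
  unfolding rho_T_def[abs_def] mu_T_def[abs_def] D_T_def[abs_def] rep_D_ext
  by (intro t_linear_intros')+

lemma t_linear_defects:
  "t_linear (\<lambda>p. ext.E2 p q)" "t_linear (ext.E2 p)"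
  "t_linear (\<lambda>p. ext.E3 p q r)" "t_linear (\<lambda>q. ext.E3 p q r)" "t_linear (ext.E3 p q)"
  unfolding rb_defect2_def[abs_def] rb_defect3_def[abs_def] bracket_T_def[abs_def]
    triple_T_def[abs_def] rep_D_ext
  by (intro t_linear_intros')+

lemma coeff_0_ext:
  "coeff (ext2 br x y) 0 = br (coeff x 0) (coeff y 0)"
  "coeff (ext2 \<rho> x p) 0 = \<rho> (coeff x 0) (coeff p 0)"
  "coeff (ext3 tr x y z) 0 = tr (coeff x 0) (coeff y 0) (coeff z 0)"
  "coeff (ext3 \<mu> x y p) 0 = \<mu> (coeff x 0) (coeff y 0) (coeff p 0)"
  "coeff (rep_D (ext2 br) (ext2 \<rho>) (ext3 \<mu>) x y p) 0 = D (coeff x 0) (coeff y 0) (coeff p 0)"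
  "coeff (T\<^sub>t p) 0 = \<TT> 0 (coeff p 0)"
  by (simp_all add: br.coeff_ext2 rho.coeff_ext2 tr.coeff_ext3 tr.rest.coeff_ext2 mu.coeff_ext3
      mu.rest.coeff_ext2 rep_D_ext D.coeff_ext3 D.rest.coeff_ext2 coeff_T\<^sub>t)

lemma coeff_0_T:
  "coeff (bracket_T (ext2 \<rho>) T\<^sub>t p q) 0 = bracket_T \<rho> (\<TT> 0) (coeff p 0) (coeff q 0)"
  "coeff (triple_T (ext2 br) (ext2 \<rho>) (ext3 \<mu>) T\<^sub>t p q r) 0
     = triple_T br \<rho> \<mu> (\<TT> 0) (coeff p 0) (coeff q 0) (coeff r 0)"
  "coeff (rho_T (ext2 br) (ext2 \<rho>) T\<^sub>t p x) 0 = rho_T br \<rho> (\<TT> 0) (coeff p 0) (coeff x 0)"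
  "coeff (mu_T (ext2 br) (ext3 tr) (ext2 \<rho>) (ext3 \<mu>) T\<^sub>t p q x) 0
     = mu_T br tr \<rho> \<mu> (\<TT> 0) (coeff p 0) (coeff q 0) (coeff x 0)"
  "coeff (D_T (ext3 tr) (ext3 \<mu>) T\<^sub>t p q x) 0
     = D_T tr \<mu> (\<TT> 0) (coeff p 0) (coeff q 0) (coeff x 0)"
  by (simp_all add: bracket_T_def triple_T_def rho_T_def mu_T_def D_T_def coeff_0_ext)

text \<open>If one of two indices with sum n + 1 is 0, the other is n + 1, where
  \<open>\<TT>\<close> vanishes. What is left of the Cauchy product is the obstruction.\<close>

lemma coeff_defect2: "coeff (ext.E2 [:u:] [:v:]) (n + 1) = Ob_I br \<rho> n \<TT> u v"
proof -
  define g where "g i j = br (\<TT> i u) (\<TT> j v) - \<TT> i (\<rho> (\<TT> j u) v - \<rho> (\<TT> j v) u)" for i j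
  have "coeff (ext.E2 [:u:] [:v:]) (n + 1) = (\<Sum>i\<le>n + 1. g i (n + 1 - i))"
    by (simp add: rb_defect2_def bracket_T_def g_def br.coeff_ext2 coeff_T\<^sub>t[of "_ - _"]
        rho.coeff_ext2_const coeff_T\<^sub>t_const sum_subtractf del: sum.atMost_Suc)
  also have "\<dots> = (\<Sum>(i, j) \<in> {(i, j). i + j = n + 1}. g i j)"
    by (rule sum.reindex_bij_witness[where i = fst and j = "\<lambda>i. (i, n + 1 - i)"]) auto
  also have "\<dots> = (\<Sum>(i, j) \<in> {(i, j). i + j = n + 1 \<and> 1 \<le> i \<and> 1 \<le> j}. g i j)"
  proof (rule sum.mono_neutral_right)
    show "finite {(i, j). i + j = n + 1}"
      by (rule finite_subset[of _ "{..n + 1} \<times> {..n + 1}"]) auto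
    have "g 0 (n + 1) = 0" "g (n + 1) 0 = 0"
      by (simp_all add: g_def beyond br.simps rho.simps \<TT>_simps)
    then show "\<forall>p\<in>{(i, j). i + j = n + 1} - {(i, j). i + j = n + 1 \<and> 1 \<le> i \<and> 1 \<le> j}.
        (case p of (i, j) \<Rightarrow> g i j) = 0"
      by (auto simp: Suc_le_eq) (metis add_0 add_0_right gr0I)+
  qed auto
  finally show ?thesis by (simp add: Ob_I_def g_def)
qed

text \<open>Here the terms that drop out are those with an index above n. A single index 0 does not
  force this, as the other two may share n + 1; hence the upper bounds in
  \<open>Ob_II\<close>.\<close>

lemma coeff_defect3: "coeff (ext.E3 [:u:] [:v:] [:w:]) (n + 1) = Ob_II br tr \<rho> \<mu> n \<TT> u v w"
proof -
  define h where "h j k = D (\<TT> j u) (\<TT> k v) w + \<mu> (\<TT> j v) (\<TT> k w) u - \<mu> (\<TT> j u) (\<TT> k w) v"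
    for j k
  define g where "g i j k = tr (\<TT> i u) (\<TT> j v) (\<TT> k w) - \<TT> i (h j k)" for i j k
  have "coeff (triple_T (ext2 br) (ext2 \<rho>) (ext3 \<mu>) T\<^sub>t [:u:] [:v:] [:w:]) l = (\<Sum>j\<le>l. h j (l - j))"
    for l
    by (simp add: triple_T_def rep_D_ext D.coeff_ext3 mu.coeff_ext3 D.rest.coeff_ext2_const
        mu.rest.coeff_ext2_const coeff_T\<^sub>t_const h_def sum_subtractf sum.distrib)
  then have "coeff (ext.E3 [:u:] [:v:] [:w:]) (n + 1)
      = (\<Sum>i\<le>n + 1. \<Sum>j\<le>n + 1 - i. g i j (n + 1 - i - j))"
    by (simp add: rb_defect3_def tr.coeff_ext3 tr.rest.coeff_ext2 coeff_T\<^sub>t_const g_def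
        coeff_T\<^sub>t[of "triple_T _ _ _ _ _ _ _"] additive.sum[OF additive_\<TT>] sum_subtractf
        del: sum.atMost_Suc)
  also have "\<dots> = (\<Sum>(i, j, k) \<in> {(i, j, k). i + j + k = n + 1}. g i j k)"
    by (subst sum.Sigma, simp, simp,
        rule sum.reindex_bij_witness[where i = "\<lambda>(i, j, k). (i, j)"
          and j = "\<lambda>(i, j). (i, j, n + 1 - i - j)"])
      auto
  also have "\<dots> = (\<Sum>(i, j, k) \<in> {(i, j, k). i + j + k = n + 1 \<and> i \<le> n \<and> j \<le> n \<and> k \<le> n}.
      g i j k)"
  proof (rule sum.mono_neutral_right)
    show "finite {(i, j, k). i + j + k = n + 1}"
      by (rule finite_subset[of _ "{..n + 1} \<times> {..n + 1} \<times> {..n + 1}"]) auto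
    have "g i j k = 0" if "n < i \<or> n < j \<or> n < k" for i j k
      using that
      by (auto simp: g_def h_def beyond tr.simps D.simps mu.simps \<TT>_simps)
    then show "\<forall>p\<in>{(i, j, k). i + j + k = n + 1}
        - {(i, j, k). i + j + k = n + 1 \<and> i \<le> n \<and> j \<le> n \<and> k \<le> n}.
        (case p of (i, j, k) \<Rightarrow> g i j k) = 0"
      by auto (metis not_le)+
  qed auto
  finally show ?thesis by (simp add: Ob_II_def g_def h_def)
qed

text \<open>Constants are replaced by polynomials one argument at a time. Arbitrary arguments are
  needed because the cocycle identities insert brackets of constants with respect to
  \<open>T\<^sub>t\<close>, which are polynomials, into the defects.\<close>

lemma jet_defects:
  assumes "\<And>u v k. k \<le> n \<Longrightarrow> coeff (ext.E2 [:u:] [:v:]) k = 0"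
    and "\<And>u v w k. k \<le> n \<Longrightarrow> coeff (ext.E3 [:u:] [:v:] [:w:]) k = 0"
  shows "jet (Suc n) (ext.E2 p q) 0 (Ob_I br \<rho> n \<TT> (coeff p 0) (coeff q 0))"
    and "jet (Suc n) (ext.E3 p q r) 0 (Ob_II br tr \<rho> \<mu> n \<TT> (coeff p 0) (coeff q 0) (coeff r 0))"
proof -
  have "jet (Suc n) (ext.E2 [:u:] [:v:]) 0 (Ob_I br \<rho> n \<TT> u v)" for u v
    using assms(1) coeff_defect2 by (simp add: jet_def)
  then have "jet (Suc n) (ext.E2 p [:v:]) 0 (Ob_I br \<rho> n \<TT> (coeff p 0) v)" for p v
    by (rule jet_t_linear_of_const[OF t_linear_defects(1)])
  then show "jet (Suc n) (ext.E2 p q) 0 (Ob_I br \<rho> n \<TT> (coeff p 0) (coeff q 0))"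
    by (rule jet_t_linear_of_const[OF t_linear_defects(2)])
  have "jet (Suc n) (ext.E3 [:u:] [:v:] [:w:]) 0 (Ob_II br tr \<rho> \<mu> n \<TT> u v w)" for u v w
    using assms(2) coeff_defect3 by (simp add: jet_def)
  then have "jet (Suc n) (ext.E3 p [:v:] [:w:]) 0 (Ob_II br tr \<rho> \<mu> n \<TT> (coeff p 0) v w)" for p v w
    by (rule jet_t_linear_of_const[OF t_linear_defects(3)])
  then have "jet (Suc n) (ext.E3 p q [:w:]) 0 (Ob_II br tr \<rho> \<mu> n \<TT> (coeff p 0) (coeff q 0) w)"
    for p q w
    by (rule jet_t_linear_of_const[OF t_linear_defects(4)])
  then show "jet (Suc n) (ext.E3 p q r) 0
      (Ob_II br tr \<rho> \<mu> n \<TT> (coeff p 0) (coeff q 0) (coeff r 0))"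
    by (rule jet_t_linear_of_const[OF t_linear_defects(5)])
qed

lemma Ob_cocycle:
  assumes "\<And>u v k. k \<le> n \<Longrightarrow> coeff (ext.E2 [:u:] [:v:]) k = 0"
    and "\<And>u v w k. k \<le> n \<Longrightarrow> coeff (ext.E3 [:u:] [:v:] [:w:]) k = 0"
  shows "delta2_I br tr \<rho> \<mu> (\<TT> 0) (Ob br tr \<rho> \<mu> n \<TT>) u1 v1 u2 v2 = 0"
    and "delta2_II br tr \<rho> \<mu> (\<TT> 0) (Ob br tr \<rho> \<mu> n \<TT>) u1 v1 u2 v2 w = 0"
proof -
  note E = jet_defects[OF assms]
  \<comment> \<open>At t^(n+1) an operator built from \<open>T\<^sub>t\<close> acts on the
    obstruction through its constant part, which is the corresponding operator of
    \<open>\<TT> 0\<close>.\<close>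
  have lead: "coeff (F p) (Suc n) = coeff (F [:x:]) 0" if "t_linear F" "jet (Suc n) p 0 x"
    for F :: "'g poly \<Rightarrow> 'g poly" and p x
    using jet_t_linear[OF that] additive.zero[OF t_linearD(1)[OF that(1)]] by (simp add: jet_def)
  note F = lead[OF _ E(1)] lead[OF _ E(2)]
  have C: "coeff (ext.E2 p q) (Suc n) = Ob_I br \<rho> n \<TT> (coeff p 0) (coeff q 0)"
    "coeff (ext.E3 p q r) (Suc n) = Ob_II br tr \<rho> \<mu> n \<TT> (coeff p 0) (coeff q 0) (coeff r 0)" for p q r
    using E by (simp_all add: jet_def)
  have "coeff (delta2_I (ext2 br) (ext3 tr) (ext2 \<rho>) (ext3 \<mu>) T\<^sub>t (ext.E2, ext.E3)
      [:u1:] [:v1:] [:u2:] [:v2:]) (Suc n) = 0"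
    by (simp add: ext.delta2_I_defect)
  then show "delta2_I br tr \<rho> \<mu> (\<TT> 0) (Ob br tr \<rho> \<mu> n \<TT>) u1 v1 u2 v2 = 0"
    by (simp add: delta2_I_def Ob_def F[OF t_linear_ops(1)] F[OF t_linear_ops(3)] C coeff_0_T)
  have "coeff (delta2_II (ext2 br) (ext3 tr) (ext2 \<rho>) (ext3 \<mu>) T\<^sub>t (ext.E2, ext.E3)
      [:u1:] [:v1:] [:u2:] [:v2:] [:w:]) (Suc n) = 0"
    by (simp add: ext.delta2_II_defect)
  then show "delta2_II br tr \<rho> \<mu> (\<TT> 0) (Ob br tr \<rho> \<mu> n \<TT>) u1 v1 u2 v2 w = 0"
    by (simp add: delta2_II_def Ob_def F[OF t_linear_ops(2)] F[OF t_linear_ops(3)] C coeff_0_T)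
qed

lemma extend:
  assumes "additive f"
  shows "additive_ly_representation_family br tr \<rho> \<mu> (Suc n) (\<TT>(Suc n := f))"
  using assms additive_\<TT> beyond by unfold_locales (auto simp: additive_def)

text \<open>Two changes add up: \<open>\<TT> 0\<close> acts on the change x of the argument, and the
  new term f t^(n+1) on the constant coefficient.\<close>

lemma jet_extend:
  assumes f: "additive f" and p: "jet (Suc n) p p' x"
  shows "jet (Suc n) (deformation_map (\<TT>(Suc n := f)) (Suc n) p) (T\<^sub>t p')
    (\<TT> 0 x + f (coeff p' 0))"
proof -
  interpret e: additive_ly_representation_family br tr \<rho> \<mu> "Suc n" "\<TT>(Suc n := f)"
    by (rule extend[OF f])
  have "jet (Suc n) (e.T\<^sub>t p') (T\<^sub>t p') (f (coeff p' 0))"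
    by (auto simp: jet_def e.coeff_T\<^sub>t coeff_T\<^sub>t beyond)
  from jet_trans[OF jet_t_linear[OF e.t_linear_T\<^sub>t p] this] show ?thesis
    by (simp add: e.coeff_T\<^sub>t_const algebra_simps)
qed

text \<open>The coboundary of f is the derivative of the defects at \<open>\<TT> 0\<close> in
  direction f, and the jet rules compute it as product rules.\<close>

lemma jet_defect_extend:
  assumes f: "additive f"
  defines "T' \<equiv> deformation_map (\<TT>(Suc n := f)) (Suc n)"
  shows "jet (Suc n) (rb_defect2 (ext2 br) (ext2 \<rho>) T' [:u:] [:v:]) (ext.E2 [:u:] [:v:])
      (delta1_I br \<rho> (\<TT> 0) f u v)" (is ?I)
    and "jet (Suc n) (rb_defect3 (ext2 br) (ext3 tr) (ext2 \<rho>) (ext3 \<mu>) T' [:u:] [:v:] [:w:])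
      (ext.E3 [:u:] [:v:] [:w:]) (delta1_II br tr \<rho> \<mu> (\<TT> 0) f u v w)" (is ?II)
proof -
  have T': "coeff (T' p) 0 = \<TT> 0 (coeff p 0)" for p
  proof -
    interpret e: additive_ly_representation_family br tr \<rho> \<mu> "Suc n" "\<TT>(Suc n := f)"
      by (rule extend[OF f])
    show ?thesis by (simp add: T'_def e.coeff_0_ext)
  qed
  have f0: "f 0 = 0" "f (x - y) = f x - f y" for x y
    using f by (simp_all add: additive.zero additive.diff)
  \<comment> \<open>This leaves the leading coefficient open: the jet rules first assemble it along
    the expression, and it is compared with the coboundary afterwards.\<close>
  have jet_cong: "jet m p q y" if "jet m p q x" "x = y" for m and p q :: "'g poly" and x y
    using that by simp
  note jets = jet_extend[OF f, folded T'_def] br.jet_ext2 tr.jet_ext3 rho.jet_ext2 mu.jet_ext3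
    D.jet_ext3 jet_add jet_diff jet_refl
  note simps = T' coeff_0_ext coeff_0_T f0 br.simps tr.simps rho.simps mu.simps D.simps \<TT>_simps
  show ?I
    unfolding rb_defect2_def bracket_T_def delta1_I_def rho_T_def
    by (rule jet_cong, (rule jets)+)
      (simp add: simps br_anti[of "f u"] algebra_simps)
  show ?II
    unfolding rb_defect3_def triple_T_def delta1_II_def D_T_def mu_T_def rep_D_ext
    by (rule jet_cong, (rule jets)+)
      (simp add: simps tr_anti[of "f v"] D_anti[of _ "f v"] rep_D_ext[symmetric] algebra_simps)
qed

end

section \<open>Passage from linear to additive structures\<close>

lemma linear_imp_additive: "Vector_Spaces.linear s1 s2 f \<Longrightarrow> additive f"
  by (simp add: Vector_Spaces.linear_iff additive_def)

lemma bilinear_map_imp_biadditive: "bilinear_map s1 s2 s3 f \<Longrightarrow> biadditive f"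
  by (simp add: bilinear_map_def Vector_Spaces.linear_iff biadditive_def)

lemma trilinear_map_imp_triadditive: "trilinear_map s1 s2 s3 s4 f \<Longrightarrow> triadditive f"
  by (simp add: trilinear_map_def Vector_Spaces.linear_iff triadditive_def biadditive_def)

lemma biadditive_alternating:
  assumes "biadditive f" and alt: "\<And>x. f x x = 0"
  shows "f x y = - f y x"
proof -
  interpret biadditive f by fact
  have "f x y + f y x = 0"
    using alt[of "x + y"] by (simp add: add_left add_right alt[of x] alt[of y] add.commute)
  then show ?thesis by (rule eq_neg_iff_add_eq_0[THEN iffD2])
qed

lemma (in lie_yamaguti_representation) additive_ly_representation:
  "additive_ly_representation br tr \<rho> \<mu>"
proof -
  interpret tr: triadditive tr
    by (rule trilinear_map_imp_triadditive[OF tr_trilinear])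
  have "br x y = - br y x" for x y
    by (rule biadditive_alternating[OF bilinear_map_imp_biadditive[OF br_bilinear] br_alternating])
  moreover have "tr x y z = - tr y x z" for x y z
    by (rule biadditive_alternating[where f = "\<lambda>x y. tr x y z"])
      (simp_all add: biadditive_def tr.simps tr_alternating)
  moreover have "\<mu> x (br y z) v = \<rho> y (\<mu> x z v) - \<rho> z (\<mu> x y v)" for x y z v
    using rep2[of x y z v] by (simp add: algebra_simps eq_diff_eq)
  moreover have "\<mu> x (tr y z w) v
      = \<mu> z w (\<mu> x y v) - \<mu> y w (\<mu> x z v) + rep_D br \<rho> \<mu> y z (\<mu> x w v)" for x y z w v
    using rep4[of z w x y v] by (simp add: algebra_simps)
  ultimately show ?thesis
    by (intro additive_ly_representation.intro additive_ly_representation_axioms.intro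
        bilinear_map_imp_biadditive[OF br_bilinear] trilinear_map_imp_triadditive[OF tr_trilinear]
        bilinear_map_imp_biadditive[OF rho_linear] trilinear_map_imp_triadditive[OF mu_linear])
      (assumption | rule LY3 LY4 rep3 rep5)+
qed

section \<open>Deformations through defects, and independence of the terms beyond order n\<close>

lemma is_deformation_iff:
  "is_deformation sg br tr sv \<rho> \<mu> T n \<TT> \<longleftrightarrow>
     \<TT> 0 = T \<and> (\<forall>i\<le>n. Vector_Spaces.linear sv sg (\<TT> i)) \<and>
     (\<forall>u v. \<forall>k\<le>n. coeff (rb_defect2 (ext2 br) (ext2 \<rho>) (deformation_map \<TT> n) [:u:] [:v:]) k = 0) \<and>
     (\<forall>u v w. \<forall>k\<le>n. coeff (rb_defect3 (ext2 br) (ext3 tr) (ext2 \<rho>) (ext3 \<mu>)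
        (deformation_map \<TT> n) [:u:] [:v:] [:w:]) k = 0)"
  if "additive_ly_representation br tr \<rho> \<mu>"
  unfolding is_deformation_def Let_def rb_defect2_def rb_defect3_def bracket_T_def triple_T_def
    additive_ly_representation.rep_D_ext[OF that] cong_mod_t_def
  by (simp add: less_Suc_eq_le)

lemma deformation_map_cong:
  "(\<And>i. i \<le> n \<Longrightarrow> \<TT> i = \<TT>' i) \<Longrightarrow> deformation_map \<TT> n = deformation_map \<TT>' n"
  by (simp add: deformation_map_def fun_eq_iff)

lemma is_deformation_cong:
  assumes "\<And>i. i \<le> n \<Longrightarrow> \<TT> i = \<TT>' i"
  shows "is_deformation sg br tr sv \<rho> \<mu> T n \<TT> \<longleftrightarrow> is_deformation sg br tr sv \<rho> \<mu> T n \<TT>'"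
  using assms deformation_map_cong[of n \<TT> \<TT>'] by (simp add: is_deformation_def)

lemma is_extensible_cong:
  assumes "\<And>i. i \<le> n \<Longrightarrow> \<TT> i = \<TT>' i"
  shows "is_extensible sg br tr sv \<rho> \<mu> T n \<TT> \<longleftrightarrow> is_extensible sg br tr sv \<rho> \<mu> T n \<TT>'"
proof -
  have "is_deformation sg br tr sv \<rho> \<mu> T (n + 1) (\<TT>(n + 1 := f))
      \<longleftrightarrow> is_deformation sg br tr sv \<rho> \<mu> T (n + 1) (\<TT>'(n + 1 := f))" for f
    by (rule is_deformation_cong) (simp add: assms)
  then show ?thesis by (simp add: is_extensible_def)
qed

lemma Ob_cong:
  fixes n :: nat
  assumes "\<And>i. i \<le> n \<Longrightarrow> \<TT> i = \<TT>' i"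
  shows "Ob br tr \<rho> \<mu> n \<TT> = Ob br tr \<rho> \<mu> n \<TT>'"
proof -
  \<comment> \<open>In the range of \<open>Ob_I\<close> the lower bounds 1 force both indices to be
    at most n.\<close>
  have "\<TT> i = \<TT>' i" "\<TT> j = \<TT>' j" if "i + j = n + 1" "1 \<le> i" "1 \<le> j" for i j
    using that by (auto intro!: assms)
  then show ?thesis
    unfolding Ob_def Ob_I_def[abs_def] Ob_II_def[abs_def]
    by (auto intro!: sum.cong ext simp: assms)
qed

section \<open>The obstruction class of a deformation\<close>

locale ly_deformation =
  lie_yamaguti_representation sg br tr sv \<rho> \<mu> + family: additive_ly_representation_family br tr \<rho> \<mu> n \<TT>
  for sg :: "'k::field_char_0 \<Rightarrow> 'g::ab_group_add \<Rightarrow> 'g"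
    and br :: "'g \<Rightarrow> 'g \<Rightarrow> 'g"
    and tr :: "'g \<Rightarrow> 'g \<Rightarrow> 'g \<Rightarrow> 'g"
    and sv :: "'k \<Rightarrow> 'v::ab_group_add \<Rightarrow> 'v"
    and \<rho> :: "'g \<Rightarrow> 'v \<Rightarrow> 'v"
    and \<mu> :: "'g \<Rightarrow> 'g \<Rightarrow> 'v \<Rightarrow> 'v"
    and n :: nat
    and \<TT> :: "nat \<Rightarrow> 'v \<Rightarrow> 'g" +
  assumes deformation: "is_deformation sg br tr sv \<rho> \<mu> (\<TT> 0) n \<TT>"
begin

lemmas deformation_iff = is_deformation_iff[OF additive_ly_representation]

lemma defects_vanish:
  "k \<le> n \<Longrightarrow> coeff (family.ext.E2 [:u:] [:v:]) k = 0"
  "k \<le> n \<Longrightarrow> coeff (family.ext.E3 [:u:] [:v:] [:w:]) k = 0"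
  using deformation by (simp_all add: deformation_iff)

lemma linear_\<TT>: "Vector_Spaces.linear sv sg (\<TT> i)"
proof (cases "i \<le> n")
  case False
  then show ?thesis
    by (simp add: Vector_Spaces.linear_iff family.beyond vector_space_axioms V.vector_space_axioms)
qed (use deformation in \<open>simp add: is_deformation_def\<close>)

text \<open>As 2 is nonzero in characteristic 0, antisymmetry of the obstruction turns back into
  alternation.\<close>

lemma eq_neg_self: "x = - x \<Longrightarrow> x = 0" for x :: 'g
proof -
  assume "x = - x"
  then have "sg 2 x = 0"
    using scale_left_distrib[of 1 1 x] by (simp add: eq_neg_iff_add_eq_0)
  then show ?thesis by simp
qed

lemma Ob_in_C2: "Ob br tr \<rho> \<mu> n \<TT> \<in> C2 sg sv"
proof -
  have scale: "\<TT> i (sv c v) = sg c (\<TT> i v)"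
    "br (sg c x) y = sg c (br x y)" "br x (sg c y) = sg c (br x y)"
    "\<rho> (sg c x) v = sv c (\<rho> x v)" "\<rho> x (sv c v) = sv c (\<rho> x v)"
    "tr (sg c x) y z = sg c (tr x y z)" "tr x (sg c y) z = sg c (tr x y z)"
    "tr x y (sg c z) = sg c (tr x y z)"
    "\<mu> (sg c x) y v = sv c (\<mu> x y v)" "\<mu> x (sg c y) v = sv c (\<mu> x y v)"
    "\<mu> x y (sv c v) = sv c (\<mu> x y v)" for c i x y z v
    using linear_\<TT> br_bilinear rho_linear tr_trilinear mu_linear
    by (simp_all add: bilinear_map_def trilinear_map_def Vector_Spaces.linear_iff)
  have D_scale: "rep_D br \<rho> \<mu> (sg c x) y v = sv c (rep_D br \<rho> \<mu> x y v)"
    "rep_D br \<rho> \<mu> x (sg c y) v = sv c (rep_D br \<rho> \<mu> x y v)"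
    "rep_D br \<rho> \<mu> x y (sv c v) = sv c (rep_D br \<rho> \<mu> x y v)" for c x y v
    by (simp_all add: rep_D_def scale V.scale_right_diff_distrib V.scale_right_distrib)
  note simps = scale D_scale family.br.simps family.tr.simps family.rho.simps family.mu.simps
    family.D.simps family.\<TT>_simps case_prod_unfold sum.distrib sum_subtractf scale_sum_right
    scale_right_distrib scale_right_diff_distrib
  have "bilinear_map sv sv sg (Ob_I br \<rho> n \<TT>)"
    unfolding bilinear_map_def Vector_Spaces.linear_iff
    by (auto simp: Ob_I_def simps vector_space_axioms V.vector_space_axioms)
  moreover have "trilinear_map sv sv sv sg (Ob_II br tr \<rho> \<mu> n \<TT>)"
    unfolding trilinear_map_def Vector_Spaces.linear_iff
    by (auto simp: Ob_II_def simps vector_space_axioms V.vector_space_axioms)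
  \<comment> \<open>The summands do not vanish one by one; alternation comes from the antisymmetry
    of the defects of \<open>T\<^sub>t\<close>.\<close>
  moreover have "Ob_I br \<rho> n \<TT> v v = 0" for v
    using family.ext.defect2_anti[of "[:v:]" "[:v:]"] family.coeff_defect2[of v v]
    by (metis coeff_minus eq_neg_self)
  moreover have "Ob_II br tr \<rho> \<mu> n \<TT> v v w = 0" for v w
    using family.ext.defect3_anti[of "[:v:]" "[:v:]" "[:w:]"] family.coeff_defect3[of v v w]
    by (metis coeff_minus eq_neg_self)
  ultimately show ?thesis by (simp add: C2_def Ob_def)
qed

lemma Ob_in_Z2: "Ob br tr \<rho> \<mu> n \<TT> \<in> Z2 sg br tr sv \<rho> \<mu> (\<TT> 0)"
  using Ob_in_C2 family.Ob_cocycle[OF defects_vanish] by (simp add: Z2_def)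

text \<open>Up to t^n the new term leaves the defects unchanged, so they still vanish there, and the
  only condition is the one at t^(n+1).\<close>

lemma deformation_extend_iff:
  assumes "Vector_Spaces.linear sv sg f"
  shows "is_deformation sg br tr sv \<rho> \<mu> (\<TT> 0) (n + 1) (\<TT>(n + 1 := f)) \<longleftrightarrow>
    (\<forall>u v. Ob_I br \<rho> n \<TT> u v + delta1_I br \<rho> (\<TT> 0) f u v = 0) \<and>
    (\<forall>u v w. Ob_II br tr \<rho> \<mu> n \<TT> u v w + delta1_II br tr \<rho> \<mu> (\<TT> 0) f u v w = 0)"
proof -
  let ?T = "deformation_map (\<TT>(Suc n := f)) (Suc n)"
  note jets = family.jet_defect_extend[OF linear_imp_additive[OF assms]]
  have "(\<forall>k\<le>Suc n. coeff (rb_defect2 (ext2 br) (ext2 \<rho>) ?T [:u:] [:v:]) k = 0) \<longleftrightarrow>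
      Ob_I br \<rho> n \<TT> u v + delta1_I br \<rho> (\<TT> 0) f u v = 0" for u v
    using jets(1)[of u v] defects_vanish(1)[of _ u v] family.coeff_defect2[of u v]
    by (auto simp: jet_def le_Suc_eq)
  moreover have "(\<forall>k\<le>Suc n. coeff (rb_defect3 (ext2 br) (ext3 tr) (ext2 \<rho>) (ext3 \<mu>) ?T
        [:u:] [:v:] [:w:]) k = 0) \<longleftrightarrow>
      Ob_II br tr \<rho> \<mu> n \<TT> u v w + delta1_II br tr \<rho> \<mu> (\<TT> 0) f u v w = 0" for u v w
    using jets(2)[of u v w] defects_vanish(2)[of _ u v w] family.coeff_defect3[of u v w]
    by (auto simp: jet_def le_Suc_eq)
  ultimately show ?thesis
    using assms linear_\<TT> by (simp add: deformation_iff)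
qed

text \<open>These rules close \<open>B2\<close> under zero, negation and sums. Negation absorbs the
  sign between the extending term and the cochain whose coboundary is the obstruction.\<close>

lemma delta1_linear:
  "delta1_I br \<rho> (\<TT> 0) (\<lambda>v. 0) u v = 0"
  "delta1_I br \<rho> (\<TT> 0) (\<lambda>v. - f v) u v = - delta1_I br \<rho> (\<TT> 0) f u v"
  "delta1_I br \<rho> (\<TT> 0) (\<lambda>v. f v + g v) u v
     = delta1_I br \<rho> (\<TT> 0) f u v + delta1_I br \<rho> (\<TT> 0) g u v"
  "delta1_II br tr \<rho> \<mu> (\<TT> 0) (\<lambda>v. 0) u v w = 0"
  "delta1_II br tr \<rho> \<mu> (\<TT> 0) (\<lambda>v. - f v) u v w = - delta1_II br tr \<rho> \<mu> (\<TT> 0) f u v w"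
  "delta1_II br tr \<rho> \<mu> (\<TT> 0) (\<lambda>v. f v + g v) u v w
     = delta1_II br tr \<rho> \<mu> (\<TT> 0) f u v w + delta1_II br tr \<rho> \<mu> (\<TT> 0) g u v w"
  by (simp_all add: delta1_I_def delta1_II_def rho_T_def mu_T_def D_T_def family.br.simps
      family.tr.simps family.rho.simps family.mu.simps family.D.simps family.\<TT>_simps
      algebra_simps)

lemma linear_uminus: "Vector_Spaces.linear sv sg f \<Longrightarrow> Vector_Spaces.linear sv sg (\<lambda>v. - f v)"
  by (simp add: Vector_Spaces.linear_iff)

lemma extensible_iff_coboundary:
  "is_extensible sg br tr sv \<rho> \<mu> (\<TT> 0) n \<TT>
     \<longleftrightarrow> Ob br tr \<rho> \<mu> n \<TT> \<in> B2 sg br tr sv \<rho> \<mu> (\<TT> 0)"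
proof
  assume "is_extensible sg br tr sv \<rho> \<mu> (\<TT> 0) n \<TT>"
  then obtain f where f: "Vector_Spaces.linear sv sg f"
    "\<And>u v. Ob_I br \<rho> n \<TT> u v = - delta1_I br \<rho> (\<TT> 0) f u v"
    "\<And>u v w. Ob_II br tr \<rho> \<mu> n \<TT> u v w = - delta1_II br tr \<rho> \<mu> (\<TT> 0) f u v w"
    using deformation_extend_iff by (auto simp: is_extensible_def eq_neg_iff_add_eq_0)
  then have "Ob br tr \<rho> \<mu> n \<TT> = (delta1_I br \<rho> (\<TT> 0) (\<lambda>v. - f v),
      delta1_II br tr \<rho> \<mu> (\<TT> 0) (\<lambda>v. - f v))"
    by (simp add: Ob_def fun_eq_iff delta1_linear)
  then show "Ob br tr \<rho> \<mu> n \<TT> \<in> B2 sg br tr sv \<rho> \<mu> (\<TT> 0)"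
    using linear_uminus[OF f(1)] by (auto simp: B2_def C1_def)
next
  assume "Ob br tr \<rho> \<mu> n \<TT> \<in> B2 sg br tr sv \<rho> \<mu> (\<TT> 0)"
  then obtain f where f: "Vector_Spaces.linear sv sg f"
    "Ob_I br \<rho> n \<TT> = delta1_I br \<rho> (\<TT> 0) f" "Ob_II br tr \<rho> \<mu> n \<TT> = delta1_II br tr \<rho> \<mu> (\<TT> 0) f"
    by (auto simp: B2_def C1_def Ob_def)
  then have "is_deformation sg br tr sv \<rho> \<mu> (\<TT> 0) (n + 1) (\<TT>(n + 1 := \<lambda>v. - f v))"
    by (subst deformation_extend_iff[OF linear_uminus]) (simp_all add: delta1_linear)
  then show "is_extensible sg br tr sv \<rho> \<mu> (\<TT> 0) n \<TT>"
    using linear_uminus[OF f(1)] by (auto simp: is_extensible_def)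
qed

text \<open>A coboundary F' in the class of F makes F the sum of the coboundaries F' and F - F'.
  Conversely, a cocycle F lies in its own class, because the zero cochain is a coboundary.\<close>

lemma trivial_class_iff:
  assumes "F \<in> Z2 sg br tr sv \<rho> \<mu> (\<TT> 0)"
  shows "is_trivial_class sg br tr sv \<rho> \<mu> (\<TT> 0) (cohomology_class sg br tr sv \<rho> \<mu> (\<TT> 0) F)
    \<longleftrightarrow> F \<in> B2 sg br tr sv \<rho> \<mu> (\<TT> 0)"
proof
  assume "is_trivial_class sg br tr sv \<rho> \<mu> (\<TT> 0) (cohomology_class sg br tr sv \<rho> \<mu> (\<TT> 0) F)"
  then obtain F' where "(F, F') \<in> cohomologous sg br tr sv \<rho> \<mu> (\<TT> 0)"
    and "F' \<in> B2 sg br tr sv \<rho> \<mu> (\<TT> 0)"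
    by (auto simp: is_trivial_class_def cohomology_class_def)
  then obtain f g where fg: "Vector_Spaces.linear sv sg f" "Vector_Spaces.linear sv sg g"
    "F' = (delta1_I br \<rho> (\<TT> 0) f, delta1_II br tr \<rho> \<mu> (\<TT> 0) f)"
    "(\<lambda>u v. fst F u v - fst F' u v) = delta1_I br \<rho> (\<TT> 0) g"
    "(\<lambda>u v w. snd F u v w - snd F' u v w) = delta1_II br tr \<rho> \<mu> (\<TT> 0) g"
    by (auto simp: cohomologous_def B2_def C1_def)
  then have "fst F u v = delta1_I br \<rho> (\<TT> 0) (\<lambda>v. f v + g v) u v"
    "snd F u v w = delta1_II br tr \<rho> \<mu> (\<TT> 0) (\<lambda>v. f v + g v) u v w" for u v w
    by (simp_all add: delta1_linear fun_eq_iff algebra_simps)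
  then have "F = (delta1_I br \<rho> (\<TT> 0) (\<lambda>v. f v + g v), delta1_II br tr \<rho> \<mu> (\<TT> 0) (\<lambda>v. f v + g v))"
    by (simp add: prod_eq_iff fun_eq_iff)
  moreover have "Vector_Spaces.linear sv sg (\<lambda>v. f v + g v)"
    using fg(1,2) by (simp add: Vector_Spaces.linear_iff scale_right_distrib algebra_simps)
  ultimately show "F \<in> B2 sg br tr sv \<rho> \<mu> (\<TT> 0)"
    by (auto simp: B2_def C1_def)
next
  assume F: "F \<in> B2 sg br tr sv \<rho> \<mu> (\<TT> 0)"
  have "Vector_Spaces.linear sv sg (\<lambda>v. 0)"
    by (simp add: Vector_Spaces.linear_iff vector_space_axioms V.vector_space_axioms)
  then have "((\<lambda>u v. 0), (\<lambda>u v w. 0)) \<in> B2 sg br tr sv \<rho> \<mu> (\<TT> 0)"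
    unfolding B2_def C1_def
    by (intro image_eqI[where x = "\<lambda>v. 0"]) (simp_all add: prod_eq_iff fun_eq_iff delta1_linear)
  then have "(F, F) \<in> cohomologous sg br tr sv \<rho> \<mu> (\<TT> 0)"
    using assms by (simp add: cohomologous_def)
  then show "is_trivial_class sg br tr sv \<rho> \<mu> (\<TT> 0) (cohomology_class sg br tr sv \<rho> \<mu> (\<TT> 0) F)"
    using F by (auto simp: is_trivial_class_def cohomology_class_def)
qed

end

theorem theorem5p14:
  fixes sg :: "'k::field_char_0 \<Rightarrow> 'g::ab_group_add \<Rightarrow> 'g"
    and br :: "'g \<Rightarrow> 'g \<Rightarrow> 'g"
    and tr :: "'g \<Rightarrow> 'g \<Rightarrow> 'g \<Rightarrow> 'g"
    and sv :: "'k \<Rightarrow> 'v::ab_group_add \<Rightarrow> 'v"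
    and \<rho> :: "'g \<Rightarrow> 'v \<Rightarrow> 'v"
    and \<mu> :: "'g \<Rightarrow> 'g \<Rightarrow> 'v \<Rightarrow> 'v"
    and T :: "'v \<Rightarrow> 'g"
    and n :: nat
    and \<TT> :: "nat \<Rightarrow> 'v \<Rightarrow> 'g"
  assumes "lie_yamaguti_representation sg br tr sv \<rho> \<mu>"
    and "relative_rota_baxter sg br tr sv \<rho> \<mu> T"
    and "is_deformation sg br tr sv \<rho> \<mu> T n \<TT>"
  shows "cohomology_class sg br tr sv \<rho> \<mu> T (Ob br tr \<rho> \<mu> n \<TT>) \<in> H2 sg br tr sv \<rho> \<mu> T
    \<and> (is_extensible sg br tr sv \<rho> \<mu> T n \<TT> \<longleftrightarrow>
        is_trivial_class sg br tr sv \<rho> \<mu> T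
          (cohomology_class sg br tr sv \<rho> \<mu> T (Ob br tr \<rho> \<mu> n \<TT>)))"
proof -
  interpret lie_yamaguti_representation sg br tr sv \<rho> \<mu> by fact
  \<comment> \<open>Truncation provides the vanishing beyond n required by the locale; by the
    congruence lemmas neither extensibility nor the obstruction changes.\<close>
  define \<TT>' where "\<TT>' i = (if i \<le> n then \<TT> i else (\<lambda>_. 0))" for i
  have eq: "\<TT> i = \<TT>' i" if "i \<le> n" for i
    using that by (simp add: \<TT>'_def)
  have T: "\<TT>' 0 = T" and lin: "\<And>i. i \<le> n \<Longrightarrow> Vector_Spaces.linear sv sg (\<TT> i)"
    using assms(3) by (simp_all add: is_deformation_def \<TT>'_def)
  have "additive (\<TT>' i)" for i
    using linear_imp_additive[OF lin] by (cases "i \<le> n") (simp_all add: \<TT>'_def additive_def)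
  moreover have "is_deformation sg br tr sv \<rho> \<mu> (\<TT>' 0) n \<TT>'"
    using assms(3) is_deformation_cong[of n \<TT> \<TT>' sg br tr sv \<rho> \<mu> T, OF eq] T by simp
  ultimately interpret ly_deformation sg br tr sv \<rho> \<mu> n \<TT>'
    by (intro ly_deformation.intro additive_ly_representation_family.intro
        additive_ly_representation_family_axioms.intro ly_deformation_axioms.intro
        assms(1) additive_ly_representation)
      (simp_all add: \<TT>'_def)
  show ?thesis
    using extensible_iff_coboundary trivial_class_iff[OF Ob_in_Z2] quotientI[OF Ob_in_Z2]
      is_extensible_cong[of n \<TT> \<TT>' sg br tr sv \<rho> \<mu> T, OF eq]
      Ob_cong[of n \<TT> \<TT>' br tr \<rho> \<mu>, OF eq]
    unfolding T H2_def cohomology_class_def by simp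
qed

end
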